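(* Let $(X,d)$ be a separable metric space, $\mu$ a finite Borel measure on $X$ such that Vitali's covering theorem is valid for $\mu$ and the family of closed balls, and let $K\colon \{(x,y)\in X\times X: x\neq y\}\to\mathbb{R}$ be a Borel measurable kernel that is antisymmetric, i.e. $K(x,y)=-K(y,x)$ for all $x\ne y$, and bounded on $\{(x,y)\in X\times X: d(x,y)>\delta\}$ for every $\delta>0$. For $\epsilon>0$ and $f\in L^2(\mu)$ put $$T_{\epsilon}(f)(x)=\int_{X\setminus B(x,\epsilon)}K(x,y)f(y)\,d\mu(y),\qquad T^{\ast}(f)(x)=\sup_{\epsilon>0}|T_{\epsilon}(f)(x)|.$$ Suppose that $T^{\ast}$ is bounded in $L^2(\mu)$, that is, there exists a constant $C_0$ such that $$\int T^{\ast}(f)^2\,d\mu\le C_0\int f^2\,d\mu\quad\text{for all } f\in L^2(\mu).$$ Then the truncated operators $T_\epsilon$ converge weakly in $L^2(\mu)$, that is, there exists a bounded linear operator $T\colon L^2(\mu)\to L^2(\mu)$ such that $$\lim_{\epsilon\to0}\int T_{\epsilon}(f)\,g\,d\mu=\int T(f)\,g\,d\mu\quad\text{for all } f,g\in L^2(\mu).$$ Moreover, for every $f\in L^2(\mu)$, $$T(f)(z)=\lim_{r\to0}\frac{1}{\mu(B(z,r))}\int_{B(z,r)}\left(\int_{X\setminus B(z,r)}K(x,y)f(y)\,d\mu(y)\right)d\mu(x)$$ for $\mu$ almost all $z\in X$.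
   Context: $B(x,r)=\{y\in X: d(x,y)<r\}$ denotes the open ball with centre $x$ and radius $r$. Functions are real-valued. "Vitali's covering theorem is valid for $\mu$ and the family of closed balls" means: whenever $A\subset X$ and $\mathcal{F}$ is a family of closed balls such that every point of $A$ is the centre of balls in $\mathcal{F}$ of arbitrarily small radii, there is a countable disjoint subfamily of $\mathcal{F}$ whose union covers $\mu$ almost all of $A$. (This holds for example if $X=\mathbb{R}^n$ or $\mu$ is doubling.) *)

theory Defs
  imports "HOL-Analysis.Analysis"
begin

class separable_metric_space = metric_space +
  assumes separable_UNIV: "\<exists>D. countable D \<and> closure D = UNIV"

text \<open>The library's results on Borel sets of products are stated for the class
  \<open>second_countable_topology\<close>.\<close>

instance separable_metric_space \<subseteq> second_countable_topology
proof
  obtain D :: "'a set" where D: "countable D" "closure D = UNIV"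
    using separable_UNIV by blast
  define B where "B = (\<lambda>(x, n). ball x (inverse (real (Suc n)))) ` (D \<times> UNIV)"
  have "topological_basis B"
  proof (rule topological_basisI)
    fix b assume "b \<in> B"
    then show "open b" by (auto simp: B_def)
  next
    fix S :: "'a set" and x assume "open S" "x \<in> S"
    then obtain e where e: "e > 0" "ball x e \<subseteq> S"
      by (meson openE)
    obtain n where n: "inverse (real (Suc n)) < e / 2"
      using reals_Archimedean[of "e / 2"] e(1) by auto
    have "x \<in> closure D" using D(2) by simp
    then obtain y where y: "y \<in> D" "dist y x < inverse (real (Suc n))"
      unfolding closure_approachable by (metis inverse_positive_iff_positive of_nat_0_less_iff zero_less_Suc)
    have "ball y (inverse (real (Suc n))) \<subseteq> ball x e"
    proof
      fix z assume "z \<in> ball y (inverse (real (Suc n)))"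
      then have "dist y z < e / 2" "dist y x < e / 2" using n y(2) by auto
      then show "z \<in> ball x e"
        using dist_triangle3[of x z y] by auto
    qed
    moreover have "x \<in> ball y (inverse (real (Suc n)))" using y(2) by simp
    moreover have "ball y (inverse (real (Suc n))) \<in> B" using y(1) by (auto simp: B_def)
    ultimately show "\<exists>b\<in>B. x \<in> b \<and> b \<subseteq> S" using e(2) by blast
  qed
  moreover have "countable B" unfolding B_def using D(1) by auto
  ultimately show "\<exists>B :: 'a set set. countable B \<and> open = generate_topology B"
    using topological_basis_imp_subbasis by blast
qed

text \<open>The set \<open>A\<close> need not be measurable.\<close>

definition vitali_valid :: "'a::metric_space measure \<Rightarrow> bool" where
  "vitali_valid M \<longleftrightarrow>
     (\<forall>A \<F>. \<F> \<subseteq> {cball x r | x r. 0 < r} \<and>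
            (\<forall>x\<in>A. \<forall>\<delta>>0. \<exists>r. 0 < r \<and> r < \<delta> \<and> cball x r \<in> \<F>) \<longrightarrow>
        (\<exists>\<G>\<subseteq>\<F>. countable \<G> \<and> disjoint \<G> \<and> (AE x in M. x \<in> A \<longrightarrow> x \<in> \<Union>\<G>)))"

text \<open>Elements of \<open>L\<^sup>2\<close> are represented by functions rather than by almost everywhere classes.\<close>

definition L2 :: "'a measure \<Rightarrow> ('a \<Rightarrow> real) set" where
  "L2 M = {f \<in> borel_measurable M. integrable M (\<lambda>x. (f x)\<^sup>2)}"

text \<open>Since \<open>L2 M\<close> consists of representatives, linearity holds almost everywhere, and the first
  two conjuncts say that \<open>T\<close> induces a map on almost everywhere classes.\<close>

definition bounded_linear_L2 ::
    "'a measure \<Rightarrow> (('a \<Rightarrow> real) \<Rightarrow> 'a \<Rightarrow> real) \<Rightarrow> bool" where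
  "bounded_linear_L2 M T \<longleftrightarrow>
     (\<forall>f\<in>L2 M. T f \<in> L2 M) \<and>
     (\<forall>f\<in>L2 M. \<forall>g\<in>L2 M. (AE x in M. f x = g x) \<longrightarrow> (AE x in M. T f x = T g x)) \<and>
     (\<forall>f\<in>L2 M. \<forall>g\<in>L2 M. AE x in M. T (\<lambda>y. f y + g y) x = T f x + T g x) \<and>
     (\<forall>c. \<forall>f\<in>L2 M. AE x in M. T (\<lambda>y. c * f y) x = c * T f x) \<and>
     (\<exists>C. \<forall>f\<in>L2 M. (LINT x|M. (T f x)\<^sup>2) \<le> C * (LINT x|M. (f x)\<^sup>2))"

text \<open>Kernels are total functions, but neither of the truncated integrals in \<open>trunc_op\<close> and
  \<open>ball_average\<close> evaluates them on the diagonal when the radius is positive.\<close>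

definition trunc_op ::
    "'a::metric_space measure \<Rightarrow> ('a \<Rightarrow> 'a \<Rightarrow> real) \<Rightarrow> real \<Rightarrow> ('a \<Rightarrow> real) \<Rightarrow> 'a \<Rightarrow> real" where
  "trunc_op M K \<epsilon> f x = (LINT y:- ball x \<epsilon>|M. K x y * f y)"

text \<open>The supremum may be infinite.\<close>

definition maximal_op ::
    "'a::metric_space measure \<Rightarrow> ('a \<Rightarrow> 'a \<Rightarrow> real) \<Rightarrow> ('a \<Rightarrow> real) \<Rightarrow> 'a \<Rightarrow> ennreal" where
  "maximal_op M K f x = (SUP \<epsilon>\<in>{0<..}. ennreal \<bar>trunc_op M K \<epsilon> f x\<bar>)"

definition ball_average ::
    "'a::metric_space measure \<Rightarrow> ('a \<Rightarrow> 'a \<Rightarrow> real) \<Rightarrow> ('a \<Rightarrow> real) \<Rightarrow> 'a \<Rightarrow> real \<Rightarrow> real" where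
  "ball_average M K f z r =
     1 / measure M (ball z r) * (LINT x:ball z r|M. (LINT y:- ball z r|M. K x y * f y))"

end

theory Submission
  imports Defs
begin

text \<open>Write \<open>form \<epsilon> f g\<close> for the integral of \<open>T\<^sub>\<epsilon> f \<cdot> g\<close>. By Fubini's theorem and antisymmetry of the
  kernel, \<open>form \<epsilon> f g = - form \<epsilon> g f\<close>; in particular \<open>form \<epsilon> f f = 0\<close>. By the maximal inequality
  all \<open>T\<^sub>\<epsilon> f\<close> have a common majorant \<open>G\<close> in \<open>L\<^sup>2\<close> (\<open>trunc_majorant\<close>), so the forms are uniformly
  bounded and their convergence has to be shown only for functions spanning a dense subspace.

  Suppose that \<open>f\<close> vanishes on an open set that contains almost all of \<open>{g \<noteq> 0}\<close>. At each point \<open>x\<close>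
  of the open set, \<open>T\<^sub>\<epsilon> f x\<close> does not depend on \<open>\<epsilon>\<close> once \<open>\<epsilon>\<close> is small, and dominated convergence
  with the majorant \<open>G\<close> gives the limit of the form (\<open>form_tendsto_separated\<close>). Now let \<open>A\<close> and \<open>B\<close> be
  sets with null boundary. Splitting off \<open>A \<inter> B\<close>, the form of their indicators is a sum of two
  separated terms and of \<open>form \<epsilon> f f\<close> with \<open>f\<close> the indicator of \<open>A \<inter> B\<close>, which is \<open>0\<close>. Sets with null
  boundary are stable under intersections and generate the Borel sets, so linear combinations of
  their indicators are dense, and the forms converge for all \<open>f\<close> and \<open>g\<close>. The limit in \<open>g\<close> is
  represented by a function bounded by \<open>G\<close>, by the Radon-Nikodym theorem
  (\<open>weak_form_represented\<close>); this function is \<open>T f\<close>, written \<open>weak_op f\<close> below.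

  For the pointwise formula let \<open>B\<close> be a ball around \<open>z\<close>. The functions \<open>f 1\<^sub>X\<^sub>-\<^sub>B\<close> and \<open>1\<^sub>B\<close> are
  separated by \<open>B\<close>, so the double integral in the ball average is the integral of \<open>T (f 1\<^sub>X\<^sub>-\<^sub>B)\<close>
  over \<open>B\<close>, that is, the integral of \<open>T f - T (f 1\<^sub>B)\<close>. As the integral of \<open>T 1\<^sub>B\<close> over \<open>B\<close> vanishes,
  \<open>f\<close> may be replaced in the second term by \<open>f - f z\<close>, and boundedness of \<open>T\<close> together with the
  Cauchy-Schwarz inequality bounds that term, divided by \<open>\<mu>(B)\<close>, by a constant times the square
  root of the average of \<open>(f - f z)\<^sup>2\<close> over \<open>B\<close>. The covering property implies Lebesgue's
  differentiation theorem (\<open>vitali_lebesgue_differentiation\<close>); applied to \<open>T f\<close>, \<open>f\<close> and \<open>f\<^sup>2\<close> it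
  completes the proof.\<close>

section \<open>Square integrable functions on a finite measure space\<close>

lemma L2_measurable: "f \<in> L2 M \<Longrightarrow> f \<in> borel_measurable M"
  by (simp add: L2_def)

lemma L2_integrable_square: "f \<in> L2 M \<Longrightarrow> integrable M (\<lambda>x. (f x)\<^sup>2)"
  by (simp add: L2_def)

lemma L2_dominated:
  fixes f g :: "'a \<Rightarrow> real"
  assumes "g \<in> L2 M" "f \<in> borel_measurable M" "AE x in M. \<bar>f x\<bar> \<le> \<bar>g x\<bar>"
  shows "f \<in> L2 M"
proof -
  have "integrable M (\<lambda>x. (f x)\<^sup>2)"
    by (rule Bochner_Integration.integrable_bound[OF L2_integrable_square[OF assms(1)]])
      (use assms in \<open>auto simp: abs_le_square_iff\<close>)
  with assms(2) show ?thesis by (simp add: L2_def)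
qed

lemma L2_integrable_mult:
  assumes f: "f \<in> L2 M" and g: "g \<in> L2 M"
  shows "integrable M (\<lambda>x. f x * g x)"
proof (rule Bochner_Integration.integrable_bound)
  show "integrable M (\<lambda>x. (f x)\<^sup>2 + (g x)\<^sup>2)"
    using f g by (simp add: L2_integrable_square)
  show "(\<lambda>x. f x * g x) \<in> borel_measurable M"
    using f[THEN L2_measurable] g[THEN L2_measurable] by measurable
  have "\<bar>a * b\<bar> \<le> a\<^sup>2 + b\<^sup>2" for a b :: real
    using sum_squares_bound[of "\<bar>a\<bar>" "\<bar>b\<bar>"] abs_ge_zero[of "a * b"] unfolding abs_mult power2_abs by linarith
  then show "AE x in M. norm (f x * g x) \<le> norm ((f x)\<^sup>2 + (g x)\<^sup>2)"
    by simp
qed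

lemma L2_add_scaled:
  assumes f: "f \<in> L2 M" and g: "g \<in> L2 M"
  shows "(\<lambda>x. f x + c * g x) \<in> L2 M"
proof -
  have "integrable M (\<lambda>x. (f x)\<^sup>2 + 2 * c * (f x * g x) + c\<^sup>2 * (g x)\<^sup>2)"
    using L2_integrable_mult[OF f g] f g by (simp add: L2_integrable_square)
  then have "integrable M (\<lambda>x. (f x + c * g x)\<^sup>2)"
    by (simp add: power2_eq_square algebra_simps)
  moreover have "(\<lambda>x. f x + c * g x) \<in> borel_measurable M"
    using f[THEN L2_measurable] g[THEN L2_measurable] by measurable
  ultimately show ?thesis by (simp add: L2_def)
qed

lemma L2_zero: "(\<lambda>x. 0) \<in> L2 M"
  by (simp add: L2_def)

lemma L2_scale: "f \<in> L2 M \<Longrightarrow> (\<lambda>x. c * f x) \<in> L2 M"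
  using L2_add_scaled[OF L2_zero, of f M c] by simp

lemma L2_diff: "f \<in> L2 M \<Longrightarrow> g \<in> L2 M \<Longrightarrow> (\<lambda>x. f x - g x) \<in> L2 M"
  using L2_add_scaled[of f M g "-1"] by simp

lemma L2_bounded:
  assumes "finite_measure M" "f \<in> borel_measurable M" "\<And>x. \<bar>f x\<bar> \<le> c"
  shows "f \<in> L2 M"
proof -
  interpret finite_measure M by fact
  have "(\<lambda>x. c) \<in> L2 M" by (simp add: L2_def)
  from this assms(2) show ?thesis
    by (rule L2_dominated) (intro AE_I2 order.trans[OF assms(3) abs_ge_self])
qed

lemma L2_indicator: "finite_measure M \<Longrightarrow> A \<in> sets M \<Longrightarrow> indicat_real A \<in> L2 M"
  by (rule L2_bounded[where c = 1]) (auto simp: indicator_def)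

lemma L2_const: "finite_measure M \<Longrightarrow> (\<lambda>x. c) \<in> L2 M"
  by (rule L2_bounded[where c = "\<bar>c\<bar>"]) auto

lemma L2_mult_indicator: "f \<in> L2 M \<Longrightarrow> A \<in> sets M \<Longrightarrow> (\<lambda>x. f x * indicat_real A x) \<in> L2 M"
  by (frule L2_measurable, rule L2_dominated[where g = f]) (auto split: split_indicator)

lemma L2_abs: "f \<in> L2 M \<Longrightarrow> (\<lambda>x. \<bar>f x\<bar>) \<in> L2 M"
  by (frule L2_measurable, rule L2_dominated[where g = f]) auto

lemma L2_integrable: "finite_measure M \<Longrightarrow> f \<in> L2 M \<Longrightarrow> integrable M f"
  using L2_integrable_mult[of f M "\<lambda>x. 1"] L2_const[of M 1] by simp

lemma L2_Cauchy_Schwarz: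
  assumes f: "f \<in> L2 M" and g: "g \<in> L2 M"
  shows "\<bar>LINT x|M. f x * g x\<bar> \<le> sqrt (LINT x|M. (f x)\<^sup>2) * sqrt (LINT x|M. (g x)\<^sup>2)"
proof -
  define a b c where "a = (LINT x|M. (f x)\<^sup>2)" "b = (LINT x|M. f x * g x)" "c = (LINT x|M. (g x)\<^sup>2)"
  have pos: "0 \<le> a + 2 * t * b + t\<^sup>2 * c" for t
  proof -
    have "(LINT x|M. (f x + t * g x)\<^sup>2)
        = (LINT x|M. (f x)\<^sup>2 + 2 * t * (f x * g x) + t\<^sup>2 * (g x)\<^sup>2)"
      by (simp add: power2_eq_square algebra_simps)
    also have "\<dots> = a + 2 * t * b + t\<^sup>2 * c"
      using L2_integrable_mult[OF f g] f g by (simp add: L2_integrable_square a_b_c_def)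
    finally have "(LINT x|M. (f x + t * g x)\<^sup>2) = a + 2 * t * b + t\<^sup>2 * c" .
    moreover have "(LINT x|M. (f x + t * g x)\<^sup>2) \<ge> 0" by simp
    ultimately show ?thesis by simp
  qed
  have "c \<ge> 0" "a \<ge> 0" by (simp_all add: a_b_c_def)
  have "b\<^sup>2 \<le> a * c"
  proof (cases "c = 0")
    case True
    then have "AE x in M. (g x)\<^sup>2 = 0"
      using integral_nonneg_eq_0_iff_AE[OF L2_integrable_square[OF g]] by (simp add: a_b_c_def)
    then have "b = (LINT x|M. 0)"
      unfolding a_b_c_def by (intro integral_cong_AE) (use L2_measurable[OF f] L2_measurable[OF g] in auto)
    then show ?thesis using True by simp
  next
    case False
    then have "c > 0" using \<open>c \<ge> 0\<close> by simp
    with pos[of "- b / c"] have "0 \<le> (a + 2 * (- b / c) * b + (- b / c)\<^sup>2 * c) * c"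
      by simp
    also have "\<dots> = a * c - b\<^sup>2" using \<open>c > 0\<close> by (simp add: field_simps power2_eq_square)
    finally show ?thesis by simp
  qed
  then have "\<bar>b\<bar> \<le> sqrt (a * c)" using real_sqrt_le_iff[of "b\<^sup>2"] by simp
  then show ?thesis by (simp add: a_b_c_def real_sqrt_mult)
qed

lemma L2_eq_AE:
  assumes u: "u \<in> L2 M" and v: "v \<in> L2 M"
    and eq: "\<And>g. g \<in> L2 M \<Longrightarrow> (LINT x|M. u x * g x) = (LINT x|M. v x * g x)"
  shows "AE x in M. u x = v x"
proof -
  let ?g = "\<lambda>x. u x - v x"
  have g: "?g \<in> L2 M" by (rule L2_diff[OF u v])
  have "(LINT x|M. (?g x)\<^sup>2) = (LINT x|M. u x * ?g x - v x * ?g x)"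
    by (simp add: power2_eq_square algebra_simps)
  also have "\<dots> = 0"
    using eq[OF g] L2_integrable_mult[OF u g] L2_integrable_mult[OF v g] by simp
  finally have "AE x in M. (?g x)\<^sup>2 = 0"
    using integral_nonneg_eq_0_iff_AE[OF L2_integrable_square[OF g]] by simp
  then show ?thesis by simp
qed

text \<open>A property of square integrable functions that is stable under linear combinations and
  under limits in the \<open>L\<^sup>2\<close> norm needs to be checked only for the indicators of a generating
  family of sets that is stable under intersections: the sets whose indicators have the property
  form a Dynkin system, and simple functions are dense.\<close>

lemma L2_induct [consumes 4, case_names generator space linear limit]:
  assumes fin: "finite_measure M"
    and gen: "sets M = sigma_sets (space M) E" "Int_stable E"
    and f: "f \<in> L2 M"
    and generator: "\<And>A. A \<in> E \<Longrightarrow> P (indicat_real A)"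
    and space: "P (indicat_real (space M))"
    and linear: "\<And>f g c. f \<in> L2 M \<Longrightarrow> g \<in> L2 M \<Longrightarrow> P f \<Longrightarrow> P g \<Longrightarrow> P (\<lambda>x. f x + c * g x)"
    and limit: "\<And>f s. f \<in> L2 M \<Longrightarrow> (\<And>n. s n \<in> L2 M) \<Longrightarrow> (\<And>n. P (s n)) \<Longrightarrow>
      (\<lambda>n. LINT x|M. (f x - s n x)\<^sup>2) \<longlonglongrightarrow> 0 \<Longrightarrow> P f"
  shows "P f"
proof -
  interpret finite_measure M by fact
  have "E \<subseteq> sets M" unfolding gen(1) by (rule sigma_sets_superset_generator)
  then have Pow: "E \<subseteq> Pow (space M)" using sets.space_closed by blast
  have cong: "P f" if "f \<in> L2 M" "g \<in> L2 M" "P g" "\<And>x. x \<in> space M \<Longrightarrow> f x = g x" for f g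
  proof (rule limit[of f "\<lambda>_. g"])
    have "(LINT x|M. (f x - g x)\<^sup>2) = (LINT x|M. 0)"
      by (rule Bochner_Integration.integral_cong) (use that in auto)
    then show "(\<lambda>n::nat. LINT x|M. (f x - g x)\<^sup>2) \<longlonglongrightarrow> 0" by simp
  qed (use that in auto)
  have ind: "indicat_real A \<in> L2 M" if "A \<in> sets M" for A
    using L2_indicator[OF fin that] .
  have zero: "P (\<lambda>x. 0)"
    using linear[OF ind ind space space, of "-1"] by simp
  have dct: "P f"
    if f: "f \<in> L2 M" and s: "\<And>n. s n \<in> L2 M" "\<And>n. P (s n)"
      and lim: "\<And>x. x \<in> space M \<Longrightarrow> (\<lambda>n. s n x) \<longlonglongrightarrow> f x"
      and bd: "\<And>n x. x \<in> space M \<Longrightarrow> \<bar>s n x\<bar> \<le> 2 * \<bar>f x\<bar>" for f and s :: "nat \<Rightarrow> _"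
  proof (rule limit[of f s])
    have "(\<lambda>n. LINT x|M. (f x - s n x)\<^sup>2) \<longlonglongrightarrow> (LINT x|M. 0)"
    proof (rule integral_dominated_convergence[where w = "\<lambda>x. 9 * (f x)\<^sup>2"])
      show "AE x in M. (\<lambda>n. (f x - s n x)\<^sup>2) \<longlonglongrightarrow> 0"
      proof (rule AE_I2)
        fix x assume "x \<in> space M"
        from tendsto_power[OF tendsto_diff[OF tendsto_const lim[OF this]], of "f x" 2]
        show "(\<lambda>n. (f x - s n x)\<^sup>2) \<longlonglongrightarrow> 0" by simp
      qed
      show "AE x in M. norm ((f x - s n x)\<^sup>2) \<le> 9 * (f x)\<^sup>2" for n
      proof (rule AE_I2)
        fix x assume "x \<in> space M"
        from bd[OF this, of n] have "\<bar>f x - s n x\<bar> \<le> 3 * \<bar>f x\<bar>" by linarith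
        then have "\<bar>f x - s n x\<bar>\<^sup>2 \<le> (3 * \<bar>f x\<bar>)\<^sup>2" by (rule power_mono) simp
        then show "norm ((f x - s n x)\<^sup>2) \<le> 9 * (f x)\<^sup>2" by (simp add: power_mult_distrib)
      qed
      show "(\<lambda>x. (f x - s n x)\<^sup>2) \<in> borel_measurable M" for n
        using L2_measurable[OF f] L2_measurable[OF s(1)] by measurable
    qed (simp_all add: L2_integrable_square[OF f])
    then show "(\<lambda>n. LINT x|M. (f x - s n x)\<^sup>2) \<longlonglongrightarrow> 0" by simp
  qed (fact f s)+
  have P_ind: "P (indicat_real A)" if "A \<in> sets M" for A
    using gen(2) Pow that[unfolded gen(1)]
  proof (induction rule: sigma_sets_induct_disjoint)
    case (basic A)
    then show ?case by (rule generator)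
  next
    case empty
    then show ?case using zero by simp
  next
    case (compl A)
    then have A: "A \<in> sets M" using gen(1) by simp
    show ?case
      by (rule cong[OF ind _ linear[OF ind ind space compl.IH, of "-1"]])
        (use A L2_diff[OF ind ind] sets.sets_into_space[OF A] in \<open>auto simp: indicator_def\<close>)
  next
    case (union A)
    then have A: "A i \<in> sets M" for i using gen(1) by auto
    have part: "(\<lambda>x. \<Sum>i<n. indicat_real (A i) x) = indicat_real (\<Union>i<n. A i)" for n
      using union.hyps(1)
      by (intro ext indicator_UN_disjoint[symmetric]) (auto simp: disjoint_family_on_def)
    have P_part: "P (indicat_real (\<Union>i<n. A i))" for n
    proof (induction n)
      case 0
      then show ?case using zero by simp
    next
      case (Suc n)
      have "P (\<lambda>x. indicat_real (\<Union>i<n. A i) x + 1 * indicat_real (A n) x)"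
        by (rule linear[OF ind ind Suc.IH union.IH]) (use A in auto)
      then show ?case by (simp add: part[symmetric])
    qed
    show ?case
    proof (rule dct[of _ "\<lambda>n. indicat_real (\<Union>i<n. A i)"])
      show "(\<lambda>n. indicat_real (\<Union>i<n. A i) x) \<longlonglongrightarrow> indicat_real (\<Union>(range A)) x" for x
        by (rule LIMSEQ_indicator_UN)
      show "indicat_real (\<Union>i. A i) \<in> L2 M" "\<And>n. indicat_real (\<Union>i<n. A i) \<in> L2 M"
        using A by (auto intro!: ind)
      show "P (indicat_real (\<Union>i<n. A i))" for n
        by (rule P_part)
    qed (simp split: split_indicator)
  qed
  have P_simple: "P (\<lambda>x. \<Sum>y\<in>Y. y * indicat_real (g -` {y} \<inter> space M) x) \<and>
      (\<lambda>x. \<Sum>y\<in>Y. y * indicat_real (g -` {y} \<inter> space M) x) \<in> L2 M"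
    if "finite Y" "g \<in> borel_measurable M" for g :: "'a \<Rightarrow> real" and Y
    using that(1)
  proof induction
    case empty
    show ?case using zero L2_zero by (simp only: sum.empty simp_thms)
  next
    case (insert y Y)
    have "g -` {y} \<inter> space M \<in> sets M" by (rule measurable_sets[OF that(2)]) simp
    note A = this [THEN ind] this [THEN P_ind]
    show ?case
      using linear[OF conjunct2[OF insert.IH] A(1) conjunct1[OF insert.IH] A(2), of y]
        L2_add_scaled[OF conjunct2[OF insert.IH] A(1), of y] insert.hyps
      by (simp only: sum.insert[OF insert.hyps] add.commute[of "y * _"])
  qed
  obtain s where s: "\<And>i. simple_function M (s i)"
    "\<And>x. x \<in> space M \<Longrightarrow> (\<lambda>i. s i x) \<longlonglongrightarrow> f x"
    "\<And>i x. x \<in> space M \<Longrightarrow> dist (s i x) 0 \<le> 2 * dist (f x) 0"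
    using borel_measurable_implies_sequence_metric[OF L2_measurable[OF f], of 0] by metis
  show ?thesis
  proof (rule dct[OF f, of s])
    fix n
    have m: "s n \<in> borel_measurable M" and fin: "finite (s n ` space M)"
      using s(1) by (auto dest: simple_functionD borel_measurable_simple_function)
    show L: "s n \<in> L2 M"
      by (rule L2_dominated[OF L2_scale[OF f, of 2] m])
        (use s(3)[of _ n] in \<open>simp add: abs_mult AE_I2\<close>)
    show "P (s n)"
      by (rule cong[OF L conjunct2[OF P_simple[OF fin m]] conjunct1[OF P_simple[OF fin m]]])
        (subst simple_function_indicator_representation_banach[OF s(1)],
          simp_all add: mult.commute)
  next
    fix n x assume "x \<in> space M"
    with s(3)[of x n] show "\<bar>s n x\<bar> \<le> 2 * \<bar>f x\<bar>" by simp
  qed (fact s(2))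
qed

section \<open>Regularity and differentiation\<close>

lemma borel_eq_sigma_sets_closed: "sets (borel :: 'a::topological_space measure) = sigma_sets UNIV (Collect closed)"
  unfolding borel_eq_closed by (rule sets_measure_of) simp

text \<open>In a metric space a closed set is the intersection of its open neighbourhoods
  \<open>{x. infdist x A < 1 / n}\<close>, and the sets that are well approximated from both sides form a
  \<open>\<sigma>\<close>-algebra.\<close>

lemma closed_open_approximation:
  fixes M :: "'a::metric_space measure"
  assumes fin: "finite_measure M" and borel: "sets M = sets borel"
    and A: "A \<in> sets M" and "e > 0"
  shows "\<exists>F U. closed F \<and> open U \<and> F \<subseteq> A \<and> A \<subseteq> U \<and> measure M (U - F) < e"
  using A[unfolded borel borel_eq_sigma_sets_closed] \<open>e > 0\<close>
proof (induction arbitrary: e rule: sigma_sets.induct)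
  case (Basic A)
  then have "closed A" by simp
  interpret finite_measure M by fact
  show ?case
  proof (cases "A = {}")
    case True
    then show ?thesis using Basic(2) by (intro exI[of _ "{}"]) auto
  next
    case False
    define U where "U n = {x. infdist x A < inverse (real (Suc n))}" for n
    have U: "open (U n)" for n
      unfolding U_def by (intro open_Collect_less continuous_intros)
    have "decseq U"
      unfolding U_def
      by (intro decseq_SucI) (auto intro: less_trans simp: less_imp_inverse_less)
    moreover have "range U \<subseteq> sets M" using U by (auto simp: borel)
    ultimately have "(\<lambda>n. measure M (U n - A)) \<longlonglongrightarrow> measure M (\<Inter>n. U n - A)"
      using \<open>closed A\<close> by (intro finite_Lim_measure_decseq) (auto simp: decseq_def borel)
    moreover have "(\<Inter>n. U n - A) = {}"
    proof -
      have False if "\<And>n. x \<in> U n" "x \<notin> A" for x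
      proof -
        have "infdist x A > 0" using infdist_pos_not_in_closed[OF \<open>closed A\<close> False] that by simp
        then obtain n where "inverse (real (Suc n)) < infdist x A" by (metis reals_Archimedean)
        with that(1)[of n] show False by (simp add: U_def)
      qed
      then show ?thesis by blast
    qed
    ultimately have lim: "(\<lambda>n. measure M (U n - A)) \<longlonglongrightarrow> 0" by (simp only: measure_empty)
    obtain n where "measure M (U n - A) < e"
      using order_tendstoD(2)[OF lim Basic(2)] unfolding eventually_sequentially by blast
    moreover have "A \<subseteq> U n" by (auto simp: U_def)
    ultimately show ?thesis using U \<open>closed A\<close> by blast
  qed
next
  case Empty
  then show ?case by (intro exI[of _ "{}"]) auto
next
  case (Compl A)
  from Compl.IH[OF Compl.prems] obtain F U where
    FU: "closed F" "open U" "F \<subseteq> A" "A \<subseteq> U" "measure M (U - F) < e" by blast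
  have "- F - (- U) = U - F" by auto
  then show ?case
    using FU by (intro exI[of _ "- U"] exI[of _ "- F"]) (auto simp: Compl_eq_Diff_UNIV[symmetric])
next
  case (Union A)
  interpret finite_measure M by fact
  \<comment> \<open>The errors of the single approximations add up to \<open>e / 2\<close>; the other half pays for replacing
    the union of all \<open>F i\<close>, which need not be closed, by a finite one.\<close>
  define d where "d i = e / 4 * (1 / 2) ^ i" for i :: nat
  have "\<exists>F U. closed F \<and> open U \<and> F \<subseteq> A i \<and> A i \<subseteq> U \<and> measure M (U - F) < d i" for i
    by (rule Union.IH) (use Union.prems in \<open>simp add: d_def\<close>)
  then obtain F U where
    FU: "\<And>i. closed (F i)" "\<And>i. open (U i)" "\<And>i. F i \<subseteq> A i" "\<And>i. A i \<subseteq> U i"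
      "\<And>i. measure M (U i - F i) < d i" by metis
  have d: "d sums (e / 2)"
    unfolding d_def using sums_mult[OF geometric_sums[of "1 / 2 :: real"], of "e / 4"] by simp
  have meas: "U i - F i \<in> sets M" "F i \<in> sets M" for i using FU by (auto simp: borel)
  have summ: "summable (\<lambda>i. measure M (U i - F i))"
    by (rule summable_comparison_test'[OF sums_summable[OF d], of 0])
      (use FU(5) in \<open>auto intro: less_imp_le\<close>)
  have "measure M (\<Union>i. U i - F i) \<le> (\<Sum>i. measure M (U i - F i))"
    using meas by (intro finite_measure_subadditive_countably summ) auto
  also have "\<dots> \<le> e / 2"
    unfolding sums_unique[OF d] by (intro suminf_le summ sums_summable[OF d] less_imp_le FU)
  finally have 1: "measure M (\<Union>i. U i - F i) \<le> e / 2" .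
  define H where "H n = (\<Union>i. F i) - (\<Union>i<n. F i)" for n
  have Hm: "H n \<in> sets M" for n unfolding H_def using meas by auto
  have "decseq H" unfolding H_def by (rule decseq_SucI) (auto simp: less_Suc_eq)
  then have "(\<lambda>n. measure M (H n)) \<longlonglongrightarrow> measure M (\<Inter>n. H n)"
    using Hm by (intro finite_Lim_measure_decseq) auto
  moreover have "(\<Inter>n. H n) = {}" unfolding H_def by auto
  ultimately have "(\<lambda>n. measure M (H n)) \<longlonglongrightarrow> 0" by simp
  then obtain n where n: "measure M (H n) < e / 2"
    using order_tendstoD(2)[of _ 0 _ "e / 2"] Union.prems by (metis eventually_sequentially half_gt_zero order_refl)
  have "measure M ((\<Union>i. U i) - (\<Union>i<n. F i)) \<le> measure M ((\<Union>i. U i - F i) \<union> H n)"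
    using meas Hm by (intro finite_measure_mono) (auto simp: H_def)
  also have "\<dots> \<le> measure M (\<Union>i. U i - F i) + measure M (H n)"
    using meas Hm by (intro measure_Un_le) auto
  finally have "measure M ((\<Union>i. U i) - (\<Union>i<n. F i)) < e" using 1 n by linarith
  moreover have "closed (\<Union>i<n. F i)" "open (\<Union>i. U i)" using FU by auto
  moreover have "(\<Union>i<n. F i) \<subseteq> (\<Union>i. A i)" "(\<Union>i. A i) \<subseteq> (\<Union>i. U i)"
    using FU(3,4) by (intro UN_mono; simp)+
  ultimately show ?case by blast
qed

lemma vitali_valid_cover:
  assumes "vitali_valid M" and "\<F> \<subseteq> {cball x r | x r. 0 < r}"
    and "\<And>x \<delta>. x \<in> A \<Longrightarrow> \<delta> > 0 \<Longrightarrow> \<exists>r. 0 < r \<and> r < \<delta> \<and> cball x r \<in> \<F>"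
  obtains \<G> where "\<G> \<subseteq> \<F>" "countable \<G>" "disjoint \<G>" "AE x in M. x \<in> A \<longrightarrow> x \<in> \<Union>\<G>"
  using assms unfolding vitali_valid_def by meson

text \<open>A point with a null ball around it is the centre of arbitrarily small null closed balls, and
  countably many of these cover almost all such points.\<close>

lemma AE_measure_ball_pos:
  fixes M :: "'a::metric_space measure"
  assumes fin: "finite_measure M" and borel: "sets M = sets borel" and vitali: "vitali_valid M"
  shows "AE x in M. \<forall>r>0. measure M (ball x r) > 0"
proof -
  interpret finite_measure M by fact
  have closed: "cball x r \<in> sets M" "ball x r \<in> sets M" for x :: 'a and r by (auto simp: borel)
  let ?A = "{x. \<exists>r>0. measure M (ball x r) = 0}"
  let ?F = "{cball x r | x r. 0 < r \<and> measure M (cball x r) = 0}"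
  have small: "\<exists>r'. 0 < r' \<and> r' < \<delta> \<and> cball x r' \<in> ?F" if x: "x \<in> ?A" and "\<delta> > 0" for x \<delta>
  proof -
    from x obtain r where r: "r > 0" "measure M (ball x r) = 0" by blast
    let ?r = "min r \<delta> / 2"
    have "measure M (cball x ?r) \<le> measure M (ball x r)"
      using r \<open>\<delta> > 0\<close> by (intro finite_measure_mono closed) auto
    then have "measure M (cball x ?r) = 0" using r by (simp add: measure_le_0_iff)
    moreover have "0 < ?r" "?r < \<delta>" using r(1) \<open>\<delta> > 0\<close> by auto
    ultimately show ?thesis by blast
  qed
  have sub: "?F \<subseteq> {cball x r | x r. 0 < r}" by blast
  obtain \<G> where G: "\<G> \<subseteq> ?F" "countable \<G>" "disjoint \<G>" "AE x in M. x \<in> ?A \<longrightarrow> x \<in> \<Union>\<G>"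
    by (rule vitali_valid_cover[OF vitali sub small])
  have "S \<in> null_sets M" if "S \<in> \<G>" for S
    using G(1) that closed by (auto simp: null_sets_def emeasure_eq_measure)
  then have "\<Union>\<G> \<in> null_sets M"
    using null_sets_UN'[OF G(2), of "\<lambda>S. S"] by simp
  then have "AE x in M. x \<notin> \<Union>\<G>" by (rule AE_not_in)
  with G(4) show ?thesis
    by eventually_elim (auto simp: zero_less_measure_iff)
qed

lemma integrable_imp_set_integrable:
  fixes f :: "'a \<Rightarrow> real"
  shows "integrable M f \<Longrightarrow> A \<in> sets M \<Longrightarrow> set_integrable M A f"
  by (simp add: set_integrable_def integrable_mult_indicator del: real_scaleR_def)

lemma set_integral_countable_disjoint_nonneg:
  fixes \<psi> :: "'a \<Rightarrow> real"
  assumes \<psi>: "integrable M \<psi>" and G: "countable \<G>" "disjoint \<G>"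
    and meas: "\<And>S. S \<in> \<G> \<Longrightarrow> S \<in> sets M"
    and nonneg: "\<And>S. S \<in> \<G> \<Longrightarrow> 0 \<le> (LINT x:S|M. \<psi> x)"
  shows "0 \<le> (LINT x:\<Union>\<G>|M. \<psi> x)"
proof -
  define A where "A n = (if n \<in> to_nat_on \<G> ` \<G> then from_nat_into \<G> n else {})" for n
  have A_in: "A n = {} \<or> A n \<in> \<G>" for n
    unfolding A_def using G(1) by auto
  have un: "(\<Union>n. A n) = \<Union>\<G>"
  proof
    show "(\<Union>n. A n) \<subseteq> \<Union>\<G>" using A_in by blast
    have "A (to_nat_on \<G> S) = S" if "S \<in> \<G>" for S
      using that G(1) by (simp add: A_def)
    then show "\<Union>\<G> \<subseteq> (\<Union>n. A n)" by blast
  qed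
  have disj: "A i \<inter> A j = {}" if "i \<noteq> j" for i j
  proof (cases "i \<in> to_nat_on \<G> ` \<G> \<and> j \<in> to_nat_on \<G> ` \<G>")
    case True
    then obtain S T where "S \<in> \<G>" "T \<in> \<G>" "i = to_nat_on \<G> S" "j = to_nat_on \<G> T" by blast
    with that G show ?thesis by (auto simp: A_def disjoint_def)
  qed (auto simp: A_def)
  have Am: "A n \<in> sets M" for n using A_in[of n] meas by auto
  note int = integrable_imp_set_integrable[OF \<psi>]
  have "0 \<le> (LINT x:A n|M. \<psi> x)" for n
    using A_in[of n] nonneg by (auto simp: set_lebesgue_integral_def)
  moreover have "(LINT x:(\<Union>i<Suc n. A i)|M. \<psi> x)
      = (LINT x:(\<Union>i<n. A i)|M. \<psi> x) + (LINT x:A n|M. \<psi> x)" for n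
  proof -
    have "A i \<inter> A n = {}" if "i < n" for i using that by (intro disj) simp
    then have "(\<Union>i<n. A i) \<inter> A n = {}" by blast
    moreover have "(\<Union>i<Suc n. A i) = (\<Union>i<n. A i) \<union> A n" by (auto simp: less_Suc_eq)
    ultimately show ?thesis using Am by (simp add: set_integral_Un int sets.finite_UN)
  qed
  ultimately have nonneg': "0 \<le> (LINT x:(\<Union>i<n. A i)|M. \<psi> x)" for n
    by (induction n) (simp_all add: set_lebesgue_integral_def)
  have lim: "(\<lambda>n. LINT x:(\<Union>i<n. A i)|M. \<psi> x) \<longlonglongrightarrow> (LINT x:(\<Union>n. \<Union>i<n. A i)|M. \<psi> x)"
    by (intro set_integral_cont_up int incseq_SucI) (use Am in \<open>auto simp: less_Suc_eq\<close>)
  have "(\<Union>n. \<Union>i<n. A i) = \<Union>\<G>" unfolding un[symmetric] by auto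
  with lim nonneg' show ?thesis
    using LIMSEQ_le_const[of "\<lambda>n. LINT x:(\<Union>i<n. A i)|M. \<psi> x" _ 0] by simp
qed

text \<open>The covering argument behind differentiation. Points where \<open>\<psi> \<le> - c\<close> although arbitrarily
  small balls have a positive integral of \<open>\<psi>\<close> are covered by disjoint such balls inside an open
  neighbourhood \<open>U\<close> of \<open>S = {\<psi> \<le> - c}\<close>. On their union \<open>W\<close> the integral of \<open>\<psi>\<close> is nonnegative,
  but it is at most \<open>- c \<mu>(W \<inter> S)\<close> plus the integral of \<open>|\<psi>|\<close> over \<open>U - S\<close>, which is
  arbitrarily small; so \<open>W \<inter> S\<close> is small. An open ball with positive integral contains
  concentric closed balls with positive integral, as the covering property speaks of closed
  balls.\<close>

lemma vitali_eventually_ball_integral_nonpos: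
  fixes M :: "'a::metric_space measure" and \<psi> :: "'a \<Rightarrow> real"
  assumes fin: "finite_measure M" and borel: "sets M = sets borel" and vitali: "vitali_valid M"
    and \<psi>: "integrable M \<psi>" and c: "c > 0"
  shows "AE z in M. \<psi> z \<le> - c \<longrightarrow> (\<forall>\<^sub>F r in at_right 0. (LINT x:ball z r|M. \<psi> x) \<le> 0)"
proof -
  interpret finite_measure M by fact
  have [simp]: "space M = UNIV" using borel sets_eq_imp_space_eq by fastforce
  have [measurable]: "\<psi> \<in> borel_measurable M" using \<psi> by simp
  note int = integrable_imp_set_integrable[OF \<psi>]
  have balls: "cball x r \<in> sets M" "ball x r \<in> sets M" for x :: 'a and r by (auto simp: borel)
  define S where "S = {z. \<psi> z \<le> - c}"
  have "{z \<in> space M. \<psi> z \<le> - c} \<in> sets M" by measurable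
  then have S: "S \<in> sets M" by (simp add: S_def)
  define E where "E = {z \<in> S. \<not> (\<forall>\<^sub>F r in at_right 0. (LINT x:ball z r|M. \<psi> x) \<le> 0)}"
  define N where "N = density M (\<lambda>x. ennreal \<bar>\<psi> x\<bar>)"
  have N: "emeasure N A = ennreal (LINT x:A|M. \<bar>\<psi> x\<bar>)" if "A \<in> sets M" for A
  proof -
    have "emeasure N A = (\<integral>\<^sup>+ x. ennreal (indicator A x * \<bar>\<psi> x\<bar>) \<partial>M)"
      unfolding N_def using that
      by (subst emeasure_density) (auto intro!: nn_integral_cong split: split_indicator)
    also have "\<dots> = ennreal (LINT x:A|M. \<bar>\<psi> x\<bar>)"
      unfolding set_lebesgue_integral_def using int[OF that] \<psi> that
      by (subst nn_integral_eq_integral) (auto simp: integrable_real_mult_indicator mult.commute)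
    finally show ?thesis .
  qed
  have N_fin: "finite_measure N"
    by (rule finite_measureI) (use N[of UNIV] sets.top[of M] in \<open>simp add: N_def\<close>)
  have N_sets: "sets N = sets borel" by (simp add: N_def borel)
  have "\<exists>Z\<in>sets M. measure M Z < e \<and> (AE x in M. x \<in> E \<longrightarrow> x \<in> Z)" if "e > 0" for e
  proof -
    have "e * c > 0" using that c by simp
    from closed_open_approximation[OF N_fin N_sets _ this, of S] S obtain F U where
      FU: "closed F" "open U" "F \<subseteq> S" "S \<subseteq> U" "measure N (U - F) < e * c"
      by (auto simp: N_sets borel)
    let ?F = "{cball x r | x r. 0 < r \<and> cball x r \<subseteq> U \<and> 0 < (LINT y:cball x r|M. \<psi> y)}"
    have small: "\<exists>r'. 0 < r' \<and> r' < \<delta> \<and> cball x r' \<in> ?F" if x: "x \<in> E" and \<delta>: "\<delta> > 0" for x \<delta>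
    proof -
      from x FU have "x \<in> U" by (auto simp: E_def)
      with FU(2) obtain \<rho> where \<rho>: "\<rho> > 0" "cball x \<rho> \<subseteq> U" by (meson open_contains_cball)
      have "\<not> (\<forall>\<^sub>F r in at_right 0. (LINT x:ball x r|M. \<psi> x) \<le> 0)" using x by (simp add: E_def)
      moreover have "\<forall>\<^sub>F r in at_right 0. r < min \<delta> \<rho>"
        using \<delta> \<rho>(1) by (intro order_tendstoD(2)[OF tendsto_ident_at]) simp
      moreover have "\<forall>\<^sub>F r in at_right (0::real). r > 0"
        by (rule eventually_at_right_less)
      ultimately obtain r where r: "0 < r" "r < \<delta>" "r < \<rho>" "0 < (LINT y:ball x r|M. \<psi> y)"
        unfolding not_eventually
        by (smt (verit, best) eventually_elim2 frequently_def min_less_iff_conj)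
      \<comment> \<open>radii increasing to \<open>r\<close>, positive from the first one on\<close>
      define s where "s n = r * (1 - inverse (real (n + 2)))" for n :: nat
      have s: "0 < s n" "s n < r" for n
        using r(1) by (simp_all add: s_def field_simps add_pos_nonneg)
      have "incseq s"
        unfolding s_def using r(1) by (intro incseq_SucI mult_left_mono) (auto simp: field_simps)
      have "s \<longlonglongrightarrow> r * (1 - 0)"
        unfolding s_def
        using LIMSEQ_ignore_initial_segment[OF lim_inverse_n, of 2] by (intro tendsto_intros) simp
      then have s_lim: "s \<longlonglongrightarrow> r" by simp
      have un: "(\<Union>n. cball x (s n)) = ball x r"
      proof
        show "(\<Union>n. cball x (s n)) \<subseteq> ball x r" by (auto intro: le_less_trans[OF _ s(2)])
        have "\<exists>n. dist x y \<le> s n" if "dist x y < r" for y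
          using order_tendstoD(1)[OF s_lim that]
          by (meson eventually_sequentially less_imp_le order_refl)
        then show "ball x r \<subseteq> (\<Union>n. cball x (s n))" by auto
      qed
      have "(\<lambda>n. LINT y:cball x (s n)|M. \<psi> y) \<longlonglongrightarrow> (LINT y:(\<Union>n. cball x (s n))|M. \<psi> y)"
        using \<open>incseq s\<close> by (intro set_integral_cont_up balls int)
          (auto simp: un balls incseq_def intro!: subset_cball)
      then have "(\<lambda>n. LINT y:cball x (s n)|M. \<psi> y) \<longlonglongrightarrow> (LINT y:ball x r|M. \<psi> y)"
        by (simp only: un)
      from order_tendstoD(1)[OF this r(4)] obtain n where "0 < (LINT y:cball x (s n)|M. \<psi> y)"
        by (meson eventually_sequentially order_refl)
      moreover have "cball x (s n) \<subseteq> U"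
        using \<rho>(2) s(2)[of n] r(3) by (auto intro: order_trans)
      ultimately show ?thesis using s[of n] r by (intro exI[of _ "s n"]) auto
    qed
    have sub: "?F \<subseteq> {cball x r | x r. 0 < r}" by blast
    obtain \<G> where G: "\<G> \<subseteq> ?F" "countable \<G>" "disjoint \<G>" "AE x in M. x \<in> E \<longrightarrow> x \<in> \<Union>\<G>"
      by (rule vitali_valid_cover[OF vitali sub small])
    define W where "W = \<Union>\<G>"
    have Gm: "S \<in> sets M" if "S \<in> \<G>" for S using G(1) that balls by auto
    then have W: "W \<in> sets M" unfolding W_def using G(2) by (intro sets.countable_Union) auto
    have "W \<subseteq> U" unfolding W_def using G(1) by auto
    have "0 \<le> (LINT x:W|M. \<psi> x)"
      unfolding W_def using G(1) Gm
      by (intro set_integral_countable_disjoint_nonneg[OF \<psi> G(2,3)]) force+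
    also have "\<dots> = (LINT x:(W \<inter> S) \<union> (W - S)|M. \<psi> x)"
      by (simp add: Int_Diff_Un)
    also have "\<dots> = (LINT x:W \<inter> S|M. \<psi> x) + (LINT x:W - S|M. \<psi> x)"
      using W S by (intro set_integral_Un int) auto
    finally have split: "0 \<le> (LINT x:W \<inter> S|M. \<psi> x) + (LINT x:W - S|M. \<psi> x)" .
    have WS: "W \<inter> S \<in> sets M" "W - S \<in> sets M" "U - F \<in> sets M"
      using W S FU(1,2) by (auto simp: borel)
    have "(LINT x:W \<inter> S|M. \<psi> x) \<le> (LINT x:W \<inter> S|M. - c)"
      using WS(1) by (intro set_integral_mono int) (auto simp: integrable_imp_set_integrable S_def)
    also have "\<dots> = - c * measure M (W \<inter> S)"
      using WS(1) by (simp add: set_lebesgue_integral_def)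
    finally have 1: "(LINT x:W \<inter> S|M. \<psi> x) \<le> - c * measure M (W \<inter> S)" .
    have "(LINT x:W - S|M. \<psi> x) \<le> (LINT x:U - F|M. \<bar>\<psi> x\<bar>)"
      unfolding set_lebesgue_integral_def
    proof (rule integral_mono)
      show "integrable M (\<lambda>x. indicat_real (W - S) x *\<^sub>R \<psi> x)"
        using int[OF WS(2)] by (simp add: set_integrable_def)
      show "integrable M (\<lambda>x. indicat_real (U - F) x *\<^sub>R \<bar>\<psi> x\<bar>)"
        using WS(3) \<psi> by (intro integrable_mult_indicator integrable_abs)
      show "indicat_real (W - S) x *\<^sub>R \<psi> x \<le> indicat_real (U - F) x *\<^sub>R \<bar>\<psi> x\<bar>" for x
        using FU(3) \<open>W \<subseteq> U\<close> by (auto split: split_indicator)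
    qed
    also have "\<dots> = measure N (U - F)"
      unfolding measure_def N[OF WS(3)] by (simp add: set_lebesgue_integral_def)
    also have "\<dots> < e * c" by (rule FU)
    finally have "measure M (W \<inter> S) * c < e * c" using split 1 by (simp add: mult.commute)
    then have "measure M (W \<inter> S) < e" using c by simp
    moreover have "AE x in M. x \<in> E \<longrightarrow> x \<in> W \<inter> S"
      using G(4) by eventually_elim (auto simp: E_def W_def)
    ultimately show ?thesis using W S by blast
  qed
  then have "\<exists>Z\<in>sets M. measure M Z < inverse (real (Suc n)) \<and> (AE x in M. x \<in> E \<longrightarrow> x \<in> Z)" for n
    by simp
  then obtain Z where Z: "\<And>n. Z n \<in> sets M" "\<And>n. measure M (Z n) < inverse (real (Suc n))"
    "\<And>n. AE x in M. x \<in> E \<longrightarrow> x \<in> Z n" by metis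
  have "measure M (\<Inter>n. Z n) \<le> 0"
  proof (rule field_le_epsilon)
    fix e :: real assume "e > 0"
    then obtain n where n: "inverse (real (Suc n)) < e" by (metis reals_Archimedean)
    have "measure M (\<Inter>n. Z n) \<le> measure M (Z n)" using Z by (intro finite_measure_mono) auto
    with Z(2)[of n] n show "measure M (\<Inter>n. Z n) \<le> 0 + e" by linarith
  qed
  then have "(\<Inter>n. Z n) \<in> null_sets M"
    using Z(1) by (auto simp: null_sets_def emeasure_eq_measure measure_le_0_iff)
  then have "AE x in M. x \<notin> (\<Inter>n. Z n)" by (rule AE_not_in)
  moreover have "AE x in M. \<forall>n. x \<in> E \<longrightarrow> x \<in> Z n" unfolding AE_all_countable using Z(3) by blast
  ultimately show ?thesis by eventually_elim (auto simp: E_def S_def)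
qed

text \<open>If \<open>\<phi> z < q\<close> for a rational \<open>q\<close>, the covering argument for \<open>\<phi> - q\<close> bounds the averages
  near \<open>z\<close> by \<open>q\<close>; there are only countably many \<open>q\<close>, and \<open>- \<phi>\<close> gives the lower bound.\<close>

lemma vitali_lebesgue_differentiation:
  fixes M :: "'a::metric_space measure" and \<phi> :: "'a \<Rightarrow> real"
  assumes fin: "finite_measure M" and borel: "sets M = sets borel" and vitali: "vitali_valid M"
    and \<phi>: "integrable M \<phi>"
  shows "AE z in M. ((\<lambda>r. (LINT x:ball z r|M. \<phi> x) / measure M (ball z r)) \<longlongrightarrow> \<phi> z) (at_right 0)"
proof -
  interpret finite_measure M by fact
  have upper: "AE z in M. \<forall>q::rat. \<forall>n::nat. \<phi> z - of_rat q \<le> - inverse (real (Suc n)) \<longrightarrow>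
      (\<forall>\<^sub>F r in at_right 0. (LINT x:ball z r|M. \<phi> x - of_rat q) \<le> 0)"
    if "integrable M \<phi>" for \<phi> :: "'a \<Rightarrow> real"
    unfolding AE_all_countable
    by (intro allI vitali_eventually_ball_integral_nonpos[OF fin borel vitali]) (use that in auto)
  have upper': "\<forall>\<^sub>F r in at_right 0. (LINT x:ball z r|M. \<phi> x) / measure M (ball z r) < a"
    if *: "\<forall>q::rat. \<forall>n::nat. \<phi> z - of_rat q \<le> - inverse (real (Suc n)) \<longrightarrow>
        (\<forall>\<^sub>F r in at_right 0. (LINT x:ball z r|M. \<phi> x - of_rat q) \<le> 0)"
      and pos: "\<forall>r>0. measure M (ball z r) > 0" and a: "\<phi> z < a" and \<phi>: "integrable M \<phi>"
    for \<phi> :: "'a \<Rightarrow> real" and z a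
  proof -
    obtain q where q: "\<phi> z < of_rat q" "of_rat q < a" using of_rat_dense[OF a] by blast
    then obtain n where "inverse (real (Suc n)) < of_rat q - \<phi> z"
      by (metis diff_gt_0_iff_gt reals_Archimedean)
    then have "\<phi> z - of_rat q \<le> - inverse (real (Suc n))" by linarith
    with * have "\<forall>\<^sub>F r in at_right 0. (LINT x:ball z r|M. \<phi> x - of_rat q) \<le> 0" by blast
    moreover have "\<forall>\<^sub>F r in at_right (0::real). r > 0" by (simp add: eventually_at_right_less)
    ultimately show ?thesis
    proof eventually_elim
      case (elim r)
      have b: "ball z r \<in> sets M" by (simp add: borel)
      have "(LINT x:ball z r|M. \<phi> x - of_rat q)
          = (LINT x:ball z r|M. \<phi> x) - (LINT x:ball z r|M. of_rat q)"
        by (rule set_integral_diff)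
          (use \<phi> b in \<open>simp_all add: integrable_imp_set_integrable\<close>)
      also have "(LINT x:ball z r|M. of_rat q) = of_rat q * measure M (ball z r)"
        using b by (simp add: set_lebesgue_integral_def)
      finally have "(LINT x:ball z r|M. \<phi> x) \<le> of_rat q * measure M (ball z r)" using elim by simp
      moreover have "measure M (ball z r) > 0" using pos elim by blast
      ultimately have "(LINT x:ball z r|M. \<phi> x) / measure M (ball z r) \<le> of_rat q"
        by (simp add: pos_divide_le_eq)
      with q(2) show ?case by linarith
    qed
  qed
  have \<phi>': "integrable M (\<lambda>x. - \<phi> x)" using \<phi> by simp
  from AE_measure_ball_pos[OF fin borel vitali] upper[OF \<phi>] upper[OF \<phi>']
  show ?thesis
  proof eventually_elim
    case (elim z)
    show ?case
    proof (rule order_tendstoI)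
      fix a assume "a < \<phi> z"
      then have "\<forall>\<^sub>F r in at_right 0. (LINT x:ball z r|M. - \<phi> x) / measure M (ball z r) < - a"
        by (intro upper'[OF elim(3,1) _ \<phi>']) simp
      then show "\<forall>\<^sub>F r in at_right 0. a < (LINT x:ball z r|M. \<phi> x) / measure M (ball z r)"
        by (simp add: set_lebesgue_integral_def)
    next
      fix a assume "\<phi> z < a"
      then show "\<forall>\<^sub>F r in at_right 0. (LINT x:ball z r|M. \<phi> x) / measure M (ball z r) < a"
        by (rule upper'[OF elim(2,1) _ \<phi>])
    qed
  qed
qed

section \<open>Sets with null boundary\<close>

lemma frontier_sublevel_subset:
  fixes h :: "'a::topological_space \<Rightarrow> real"
  assumes "continuous_on UNIV h"
  shows "frontier {x. h x \<le> r} \<subseteq> {x. h x = r}"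
proof -
  have "closed {x. h x \<le> r}" "open {x. h x < r}"
    using assms by (auto intro!: closed_Collect_le open_Collect_less continuous_intros)
  then have "{x. h x < r} \<subseteq> interior {x. h x \<le> r}"
    by (intro interior_maximal) auto
  moreover have "closure {x. h x \<le> r} = {x. h x \<le> r}"
    using \<open>closed {x. h x \<le> r}\<close> by simp
  ultimately show ?thesis unfolding frontier_def by force
qed

definition continuity_sets :: "'a::topological_space measure \<Rightarrow> 'a set set" where
  "continuity_sets M = {A \<in> sets M. frontier A \<in> null_sets M}"

lemma Int_stable_continuity_sets:
  assumes "sets M = sets borel"
  shows "Int_stable (continuity_sets M)"
proof (rule Int_stableI)
  fix A B assume AB: "A \<in> continuity_sets M" "B \<in> continuity_sets M"
  then have "frontier A \<union> frontier B \<in> null_sets M" by (auto simp: continuity_sets_def)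
  then have "frontier (A \<inter> B) \<in> null_sets M"
    by (rule null_sets_subset) (use assms frontier_Int_subset in auto)
  with AB show "A \<inter> B \<in> continuity_sets M" by (auto simp: continuity_sets_def)
qed

text \<open>The level sets \<open>{x. infdist x A = r}\<close> are disjoint for distinct \<open>r\<close>, so only countably many of
  them have positive measure; a closed set \<open>A\<close> is therefore a countable intersection of closed
  neighbourhoods \<open>{x. infdist x A \<le> r}\<close> with null boundary.\<close>

lemma sigma_sets_continuity_sets:
  fixes M :: "'a::metric_space measure"
  assumes fin: "finite_measure M" and borel: "sets M = sets borel"
  shows "sets M = sigma_sets (space M) (continuity_sets M)"
proof
  interpret finite_measure M by fact
  have space: "space M = UNIV" using borel sets_eq_imp_space_eq by fastforce
  show "sigma_sets (space M) (continuity_sets M) \<subseteq> sets M"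
    by (intro sets.sigma_sets_subset) (auto simp: continuity_sets_def)
  interpret S: sigma_algebra UNIV "sigma_sets UNIV (continuity_sets M)"
    by (rule sigma_algebra_sigma_sets) simp
  have "A \<in> sigma_sets UNIV (continuity_sets M)" if A: "closed A" for A
  proof (cases "A = {}")
    case True
    then show ?thesis by simp
  next
    case False
    let ?h = "\<lambda>x. infdist x A"
    have cont: "continuous_on UNIV ?h" by (intro continuous_intros)
    then have h: "?h \<in> measurable M borel"
      using borel_measurable_continuous_onI measurable_cong_sets[OF borel refl] by blast
    interpret D: finite_measure "distr M borel ?h"
      by (rule finite_measure_distr[OF h])
    have "\<exists>r. 0 < r \<and> r < inverse (real (Suc n)) \<and> measure (distr M borel ?h) {r} = 0" for n
    proof (rule ccontr)
      assume "\<not> ?thesis"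
      then have "{0<..<inverse (real (Suc n))} \<subseteq> {r. measure (distr M borel ?h) {r} \<noteq> 0}" by auto
      then have "countable {0<..<inverse (real (Suc n))}"
        using D.countable_support by (rule countable_subset)
      then show False
        using uncountable_open_interval[of 0 "inverse (real (Suc n))"] by simp
    qed
    then obtain r where r: "\<And>n. 0 < r n" "\<And>n. r n < inverse (real (Suc n))"
      "\<And>n. measure (distr M borel ?h) {r n} = 0" by metis
    have "{x. ?h x \<le> r n} \<in> continuity_sets M" for n
    proof -
      have "closed {x. ?h x \<le> r n}"
        by (intro closed_Collect_le continuous_intros)
      moreover have "{x. ?h x = r n} \<in> null_sets M"
      proof -
        have "?h -` {r n} \<inter> space M \<in> sets M" using h by (rule measurable_sets) simp
        moreover have "measure M (?h -` {r n} \<inter> space M) = 0"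
          using r(3)[of n] h by (simp add: measure_distr)
        ultimately show ?thesis
          by (simp add: null_sets_def emeasure_eq_measure space vimage_def)
      qed
      then have "frontier {x. ?h x \<le> r n} \<in> null_sets M"
        by (rule null_sets_subset) (use frontier_sublevel_subset[OF cont] borel in auto)
      ultimately show ?thesis by (auto simp: continuity_sets_def borel)
    qed
    then have "(\<Inter>n. {x. ?h x \<le> r n}) \<in> sigma_sets UNIV (continuity_sets M)"
      by (intro S.countable_INT) auto
    also have "(\<Inter>n. {x. ?h x \<le> r n}) = A"
    proof
      show "A \<subseteq> (\<Inter>n. {x. ?h x \<le> r n})" using r(1) by (auto intro: less_imp_le)
      have "x \<in> A" if x: "\<And>n. ?h x \<le> r n" for x
      proof (rule ccontr)
        assume "x \<notin> A"
        then have "0 < ?h x" by (rule infdist_pos_not_in_closed[OF A False])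
        then obtain n where "inverse (real (Suc n)) < ?h x" by (metis reals_Archimedean)
        with x[of n] r(2)[of n] show False by linarith
      qed
      then show "(\<Inter>n. {x. ?h x \<le> r n}) \<subseteq> A" by blast
    qed
    finally show ?thesis .
  qed
  then have "sigma_sets UNIV (Collect closed) \<subseteq> sigma_sets UNIV (continuity_sets M)"
    by (intro sigma_sets_mono) auto
  then show "sets M \<subseteq> sigma_sets (space M) (continuity_sets M)"
    unfolding borel borel_eq_sigma_sets_closed space .
qed

section \<open>Uniform approximation of limits\<close>

lemma tendsto_of_uniform_approximation:
  fixes h :: "'b \<Rightarrow> real"
  assumes F: "F \<noteq> bot"
    and approx: "\<And>e. e > 0 \<Longrightarrow> \<exists>h' l. (h' \<longlongrightarrow> l) F \<and> (\<forall>\<^sub>F x in F. \<bar>h x - h' x\<bar> \<le> e)"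
  shows "\<exists>l. (h \<longlongrightarrow> l) F"
proof -
  have "cauchy_filter (filtermap h F)"
    unfolding cauchy_filter_metric_filtermap
  proof (intro allI impI)
    fix e :: real assume "e > 0"
    then have e: "e / 8 > 0" by simp
    from approx[OF this] obtain h' l where
      h': "(h' \<longlongrightarrow> l) F" "\<forall>\<^sub>F x in F. \<bar>h x - h' x\<bar> \<le> e / 8" by blast
    let ?P = "\<lambda>x. \<bar>h x - l\<bar> < e / 2"
    from tendstoD[OF h'(1) e] h'(2) have "eventually ?P F"
      by eventually_elim (use \<open>e > 0\<close> in \<open>simp add: dist_real_def abs_if split: if_splits\<close>)
    moreover have "dist (h x) (h y) < e" if "?P x \<and> ?P y" for x y
      using that unfolding dist_real_def by linarith
    ultimately show "\<exists>P. eventually P F \<and> (\<forall>x y. P x \<and> P y \<longrightarrow> dist (h x) (h y) < e)"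
      by blast
  qed
  then have "convergent_filter (filtermap h F)"
    using F by (intro cauchy_filter_convergent) (simp_all add: filtermap_bot_iff)
  then show ?thesis
    by (simp add: convergent_filter_iff filterlim_def)
qed

section \<open>Truncated operators dominated by a bounded maximal operator\<close>

text \<open>Values on the diagonal do not affect truncations of positive radius, so measurability and antisymmetry may be
  imposed on the whole product; antisymmetry then says that the diagonal values are \<open>0\<close>.\<close>

locale bounded_maximal_kernel = finite_measure M
  for M :: "'a::{metric_space, second_countable_topology} measure" +
  fixes K :: "'a \<Rightarrow> 'a \<Rightarrow> real" and C :: real
  assumes borel: "sets M = sets borel"
    and K_measurable: "(\<lambda>(x, y). K x y) \<in> borel_measurable borel"
    and K_antisym: "K x y = - K y x"
    and K_bounded: "\<delta> > 0 \<Longrightarrow> \<exists>c. \<forall>x y. \<delta> \<le> dist x y \<longrightarrow> \<bar>K x y\<bar> \<le> c"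
    and C_nonneg: "0 \<le> C"
    and maximal_bounded: "f \<in> L2 M \<Longrightarrow>
      (\<integral>\<^sup>+ x. (maximal_op M K f x)\<^sup>2 \<partial>M) \<le> ennreal (C * (LINT x|M. (f x)\<^sup>2))"
begin

lemma space_M [simp]: "space M = UNIV"
  using borel sets_eq_imp_space_eq by fastforce

lemma ball_sets [simp]: "ball x r \<in> sets M"
  by (simp add: borel)

sublocale pair: pair_sigma_finite M M ..

definition trunc_kernel :: "real \<Rightarrow> 'a \<Rightarrow> 'a \<Rightarrow> real" where
  "trunc_kernel \<epsilon> x y = indicat_real (- ball x \<epsilon>) y * K x y"

lemma sets_pair: "sets (M \<Otimes>\<^sub>M M) = sets borel"
  using sets_pair_measure_cong[OF borel borel] by (simp only: borel_prod)

lemma measurable_pair_eq: "borel_measurable (M \<Otimes>\<^sub>M M) = borel_measurable borel"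
  by (rule measurable_cong_sets[OF sets_pair refl])

lemma K_measurable_pair: "(\<lambda>p. K (fst p) (snd p)) \<in> borel_measurable (M \<Otimes>\<^sub>M M)"
  using K_measurable by (simp add: measurable_pair_eq case_prod_beta')

lemma trunc_kernel_measurable: "(\<lambda>p. trunc_kernel \<epsilon> (fst p) (snd p)) \<in> borel_measurable (M \<Otimes>\<^sub>M M)"
proof -
  have "closed {p :: 'a \<times> 'a. \<epsilon> \<le> dist (fst p) (snd p)}"
    by (intro closed_Collect_le continuous_intros)
  then have "indicat_real {p :: 'a \<times> 'a. \<epsilon> \<le> dist (fst p) (snd p)} \<in> borel_measurable (M \<Otimes>\<^sub>M M)"
    unfolding measurable_pair_eq by (intro borel_measurable_indicator borel_closed)
  then have "(\<lambda>p. indicat_real {p :: 'a \<times> 'a. \<epsilon> \<le> dist (fst p) (snd p)} p * K (fst p) (snd p))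
      \<in> borel_measurable (M \<Otimes>\<^sub>M M)"
    by (intro borel_measurable_times K_measurable_pair)
  also have "(\<lambda>p. indicat_real {p :: 'a \<times> 'a. \<epsilon> \<le> dist (fst p) (snd p)} p * K (fst p) (snd p))
      = (\<lambda>p. trunc_kernel \<epsilon> (fst p) (snd p))"
    by (intro ext) (auto simp: trunc_kernel_def indicator_def not_less)
  finally show ?thesis .
qed

lemma trunc_kernel_measurable_snd: "trunc_kernel \<epsilon> x \<in> borel_measurable M"
  using measurable_compose[OF measurable_Pair1' trunc_kernel_measurable, of x \<epsilon>] by simp

lemma trunc_kernel_bounded:
  assumes "\<epsilon> > 0"
  obtains c where "c \<ge> 0" "\<And>x y. \<bar>trunc_kernel \<epsilon> x y\<bar> \<le> c"
proof -
  from K_bounded[OF assms] obtain c where c: "\<And>x y. \<epsilon> \<le> dist x y \<Longrightarrow> \<bar>K x y\<bar> \<le> c" by blast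
  have "\<bar>trunc_kernel \<epsilon> x y\<bar> \<le> max 0 c" for x y
    using c[of x y] by (auto simp: trunc_kernel_def indicator_def)
  then show ?thesis using that[of "max 0 c"] by simp
qed

lemma trunc_kernel_antisym: "trunc_kernel \<epsilon> x y = - trunc_kernel \<epsilon> y x"
  using K_antisym[of x y] by (simp add: trunc_kernel_def indicator_def dist_commute)

abbreviation trunc :: "real \<Rightarrow> ('a \<Rightarrow> real) \<Rightarrow> 'a \<Rightarrow> real" where
  "trunc \<equiv> trunc_op M K"

lemma trunc_eq: "trunc \<epsilon> f x = (LINT y|M. trunc_kernel \<epsilon> x y * f y)"
  by (simp add: trunc_op_def set_lebesgue_integral_def trunc_kernel_def mult.assoc)

lemma trunc_integrable:
  assumes "\<epsilon> > 0" "f \<in> L2 M"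
  shows "integrable M (\<lambda>y. trunc_kernel \<epsilon> x y * f y)"
proof -
  obtain c where c: "c \<ge> 0" "\<And>x y. \<bar>trunc_kernel \<epsilon> x y\<bar> \<le> c"
    using trunc_kernel_bounded[OF assms(1)] by blast
  have "trunc_kernel \<epsilon> x \<in> L2 M"
    by (rule L2_bounded[OF finite_measure_axioms trunc_kernel_measurable_snd c(2)])
  then show ?thesis using assms(2) by (rule L2_integrable_mult)
qed

lemma trunc_add_scaled:
  assumes "\<epsilon> > 0" "f \<in> L2 M" "g \<in> L2 M"
  shows "trunc \<epsilon> (\<lambda>x. f x + c * g x) x = trunc \<epsilon> f x + c * trunc \<epsilon> g x"
proof -
  have "trunc \<epsilon> (\<lambda>x. f x + c * g x) x
      = (LINT y|M. trunc_kernel \<epsilon> x y * f y + c * (trunc_kernel \<epsilon> x y * g y))"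
    unfolding trunc_eq by (simp add: algebra_simps)
  also have "\<dots> = trunc \<epsilon> f x + c * trunc \<epsilon> g x"
    unfolding trunc_eq using assms by (simp add: trunc_integrable)
  finally show ?thesis .
qed

lemma kernel_integral_measurable:
  assumes k: "(\<lambda>p. k (fst p) (snd p)) \<in> borel_measurable (M \<Otimes>\<^sub>M M)" and f: "f \<in> borel_measurable M"
  shows "(\<lambda>x. LINT y|M. k x y * f y :: real) \<in> borel_measurable M"
proof -
  have "(\<lambda>p. k (fst p) (snd p) * f (snd p)) \<in> borel_measurable (M \<Otimes>\<^sub>M M)"
    using k measurable_compose[OF measurable_snd f] by (rule borel_measurable_times)
  then show ?thesis by (intro borel_measurable_lebesgue_integral) (simp add: case_prod_beta')
qed

lemma trunc_measurable: "f \<in> L2 M \<Longrightarrow> trunc \<epsilon> f \<in> borel_measurable M"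
  unfolding trunc_eq[abs_def]
  by (intro kernel_integral_measurable trunc_kernel_measurable L2_measurable)

text \<open>The truncations are left continuous in the radius, because they integrate over complements
  of open balls. Hence the supremum over rational radii already is the maximal operator, which
  makes the latter measurable.\<close>

lemma trunc_left_continuous:
  assumes f: "f \<in> L2 M" and s: "\<And>n. \<epsilon> / 2 \<le> s n" "\<And>n. s n < \<epsilon>" "s \<longlonglongrightarrow> \<epsilon>" and \<epsilon>: "\<epsilon> > 0"
  shows "(\<lambda>n. trunc (s n) f x) \<longlonglongrightarrow> trunc \<epsilon> f x"
proof -
  have \<epsilon>2: "\<epsilon> / 2 > 0" using \<epsilon> by simp
  show ?thesis
    unfolding trunc_eq
  proof (rule integral_dominated_convergence[where w = "\<lambda>y. \<bar>trunc_kernel (\<epsilon> / 2) x y * f y\<bar>"])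
    show "(\<lambda>y. trunc_kernel \<epsilon> x y * f y) \<in> borel_measurable M"
      "\<And>n. (\<lambda>y. trunc_kernel (s n) x y * f y) \<in> borel_measurable M"
      by (intro borel_measurable_times trunc_kernel_measurable_snd L2_measurable[OF f])+
    show "integrable M (\<lambda>y. \<bar>trunc_kernel (\<epsilon> / 2) x y * f y\<bar>)"
      by (intro integrable_abs trunc_integrable \<epsilon>2 f)
    show "AE y in M. norm (trunc_kernel (s n) x y * f y) \<le> \<bar>trunc_kernel (\<epsilon> / 2) x y * f y\<bar>" for n
      using s(1)[of n] by (intro AE_I2) (auto simp: trunc_kernel_def indicator_def)
    show "AE y in M. (\<lambda>n. trunc_kernel (s n) x y * f y) \<longlonglongrightarrow> trunc_kernel \<epsilon> x y * f y"
    proof (rule AE_I2)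
      fix y
      have "\<forall>\<^sub>F n in sequentially. dist x y < s n \<longleftrightarrow> dist x y < \<epsilon>"
      proof (cases "dist x y < \<epsilon>")
        case True
        then show ?thesis using order_tendstoD(1)[OF s(3) True] by simp
      next
        case False
        then have "\<not> dist x y < s n" for n using s(2)[of n] by simp
        with False show ?thesis by simp
      qed
      then have "\<forall>\<^sub>F n in sequentially. trunc_kernel (s n) x y * f y = trunc_kernel \<epsilon> x y * f y"
        by eventually_elim (simp add: trunc_kernel_def indicator_def)
      then show "(\<lambda>n. trunc_kernel (s n) x y * f y) \<longlonglongrightarrow> trunc_kernel \<epsilon> x y * f y"
        by (rule tendsto_eventually)
    qed
  qed
qed

lemma maximal_op_eq_rational:
  assumes f: "f \<in> L2 M"
  shows "maximal_op M K f x = (SUP q\<in>{q::rat. 0 < q}. ennreal \<bar>trunc (of_rat q) f x\<bar>)" (is "_ = ?R")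
proof (rule antisym)
  show "maximal_op M K f x \<le> ?R"
    unfolding maximal_op_def
  proof (rule SUP_least)
    fix \<epsilon> :: real assume "\<epsilon> \<in> {0<..}"
    then have \<epsilon>: "\<epsilon> > 0" by simp
    have "\<exists>q. max (\<epsilon> / 2) (\<epsilon> - inverse (real (Suc n))) < of_rat q \<and> of_rat q < \<epsilon>" for n
      using of_rat_dense[of "max (\<epsilon> / 2) (\<epsilon> - inverse (real (Suc n)))" \<epsilon>] \<epsilon> by auto
    then obtain q where q: "\<And>n. max (\<epsilon> / 2) (\<epsilon> - inverse (real (Suc n))) < of_rat (q n)"
      "\<And>n. of_rat (q n) < \<epsilon>" by metis
    have "(\<lambda>n. \<epsilon> - inverse (real (Suc n))) \<longlonglongrightarrow> \<epsilon> - 0"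
      by (intro tendsto_diff tendsto_const LIMSEQ_inverse_real_of_nat)
    then have low: "(\<lambda>n. \<epsilon> - inverse (real (Suc n))) \<longlonglongrightarrow> \<epsilon>" by simp
    have "(\<lambda>n. real_of_rat (q n)) \<longlonglongrightarrow> \<epsilon>"
      by (rule tendsto_sandwich[OF _ _ low tendsto_const])
        (use q in \<open>auto intro!: always_eventually less_imp_le\<close>)
    then have "(\<lambda>n. trunc (of_rat (q n)) f x) \<longlonglongrightarrow> trunc \<epsilon> f x"
      using q \<epsilon> by (intro trunc_left_continuous[OF f]) (auto intro: less_imp_le)
    then have lim: "(\<lambda>n. ennreal \<bar>trunc (of_rat (q n)) f x\<bar>) \<longlonglongrightarrow> ennreal \<bar>trunc \<epsilon> f x\<bar>"
      by (intro tendsto_ennrealI tendsto_rabs)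
    have "ennreal \<bar>trunc (of_rat (q n)) f x\<bar> \<le> ?R" for n
    proof (rule SUP_upper)
      have "0 < real_of_rat (q n)" using q(1)[of n] \<epsilon> by linarith
      then show "q n \<in> {q. 0 < q}" by simp
    qed
    then show "ennreal \<bar>trunc \<epsilon> f x\<bar> \<le> ?R"
      using LIMSEQ_le_const2[OF lim] by blast
  qed
  show "?R \<le> maximal_op M K f x"
    unfolding maximal_op_def by (rule SUP_mono) auto
qed

lemma maximal_op_measurable:
  assumes f: "f \<in> L2 M"
  shows "maximal_op M K f \<in> borel_measurable M"
proof -
  note [measurable] = trunc_measurable[OF f]
  have "(\<lambda>x. SUP q\<in>{q::rat. 0 < q}. ennreal \<bar>trunc (of_rat q) f x\<bar>) \<in> borel_measurable M"
    by (intro borel_measurable_SUP) auto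
  then show ?thesis by (simp add: maximal_op_eq_rational[OF f, abs_def])
qed

text \<open>The only consequence of the boundedness of the maximal operator that is used below: the
  truncations have a common square integrable majorant.\<close>

lemma trunc_majorant:
  assumes f: "f \<in> L2 M"
  obtains G where "G \<in> L2 M" "\<And>x. 0 \<le> G x" "(LINT x|M. (G x)\<^sup>2) \<le> C * (LINT x|M. (f x)\<^sup>2)"
    "AE x in M. \<forall>\<epsilon>>0. \<bar>trunc \<epsilon> f x\<bar> \<le> G x"
proof
  define G where "G x = enn2real (maximal_op M K f x)" for x
  note [measurable] = maximal_op_measurable[OF f]
  have G: "G \<in> borel_measurable M" unfolding G_def by measurable
  have bound: "(\<integral>\<^sup>+ x. (maximal_op M K f x)\<^sup>2 \<partial>M) \<le> ennreal (C * (LINT x|M. (f x)\<^sup>2))"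
    by (rule maximal_bounded[OF f])
  then have "(\<integral>\<^sup>+ x. (maximal_op M K f x)\<^sup>2 \<partial>M) \<noteq> \<infinity>"
    by (metis ennreal_less_top infinity_ennreal_def leD)
  then have "AE x in M. (maximal_op M K f x)\<^sup>2 \<noteq> \<infinity>"
    by (intro nn_integral_PInf_AE) measurable
  then have fin: "AE x in M. maximal_op M K f x < top"
    by eventually_elim (auto simp: power2_eq_square less_top ennreal_mult_eq_top_iff)
  then have eq: "AE x in M. ennreal ((G x)\<^sup>2) = (maximal_op M K f x)\<^sup>2"
  proof eventually_elim
    case (elim x)
    then have "ennreal (G x) = maximal_op M K f x" unfolding G_def by simp
    moreover have "0 \<le> G x" by (simp add: G_def)
    ultimately show ?case by (metis ennreal_power)
  qed
  have nn: "(\<integral>\<^sup>+ x. ennreal ((G x)\<^sup>2) \<partial>M) \<le> ennreal (C * (LINT x|M. (f x)\<^sup>2))"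
    using bound nn_integral_cong_AE[OF eq] by simp
  have "integrable M (\<lambda>x. (G x)\<^sup>2)"
    using G nn by (intro integrableI_bounded) (auto simp: le_less_trans[OF _ ennreal_less_top])
  then show "G \<in> L2 M" using G by (simp add: L2_def)
  show "0 \<le> G x" for x by (simp add: G_def)
  show "(LINT x|M. (G x)\<^sup>2) \<le> C * (LINT x|M. (f x)\<^sup>2)"
    using nn nn_integral_eq_integral[OF \<open>integrable M (\<lambda>x. (G x)\<^sup>2)\<close>] C_nonneg
    by (simp add: ennreal_le_iff)
  show "AE x in M. \<forall>\<epsilon>>0. \<bar>trunc \<epsilon> f x\<bar> \<le> G x"
    using fin
  proof eventually_elim
    case (elim x)
    show ?case
    proof (intro allI impI)
      fix \<epsilon> :: real assume "\<epsilon> > 0"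
      then have "ennreal \<bar>trunc \<epsilon> f x\<bar> \<le> maximal_op M K f x"
        unfolding maximal_op_def by (intro SUP_upper) simp
      also have "\<dots> = ennreal (G x)" using elim unfolding G_def by simp
      finally show "\<bar>trunc \<epsilon> f x\<bar> \<le> G x" by (simp add: G_def)
    qed
  qed
qed

lemma trunc_L2: "\<epsilon> > 0 \<Longrightarrow> f \<in> L2 M \<Longrightarrow> trunc \<epsilon> f \<in> L2 M"
proof (rule trunc_majorant[of f])
  fix G assume *: "\<epsilon> > 0" "f \<in> L2 M" "G \<in> L2 M" "\<And>x. 0 \<le> G x"
    "AE x in M. \<forall>\<epsilon>>0. \<bar>trunc \<epsilon> f x\<bar> \<le> G x"
  from *(5) have "AE x in M. \<bar>trunc \<epsilon> f x\<bar> \<le> \<bar>G x\<bar>"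
    by eventually_elim (use *(1) abs_ge_self order_trans in blast)
  with *(3) trunc_measurable[OF *(2)] show ?thesis by (rule L2_dominated)
qed

section \<open>Weak convergence\<close>

definition form :: "real \<Rightarrow> ('a \<Rightarrow> real) \<Rightarrow> ('a \<Rightarrow> real) \<Rightarrow> real" where
  "form \<epsilon> f g = (LINT x|M. trunc \<epsilon> f x * g x)"

lemma form_add_scaled_left:
  assumes "\<epsilon> > 0" "f \<in> L2 M" "g \<in> L2 M" "h \<in> L2 M"
  shows "form \<epsilon> (\<lambda>x. f x + c * g x) h = form \<epsilon> f h + c * form \<epsilon> g h"
proof -
  have "form \<epsilon> (\<lambda>x. f x + c * g x) h = (LINT x|M. trunc \<epsilon> f x * h x + c * (trunc \<epsilon> g x * h x))"
    unfolding form_def using assms by (simp add: trunc_add_scaled algebra_simps)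
  also have "\<dots> = form \<epsilon> f h + c * form \<epsilon> g h"
    unfolding form_def using assms by (simp add: L2_integrable_mult trunc_L2)
  finally show ?thesis .
qed

lemma form_add_scaled_right:
  assumes "\<epsilon> > 0" "f \<in> L2 M" "g \<in> L2 M" "h \<in> L2 M"
  shows "form \<epsilon> f (\<lambda>x. g x + c * h x) = form \<epsilon> f g + c * form \<epsilon> f h"
proof -
  have "form \<epsilon> f (\<lambda>x. g x + c * h x) = (LINT x|M. trunc \<epsilon> f x * g x + c * (trunc \<epsilon> f x * h x))"
    unfolding form_def by (simp add: algebra_simps)
  also have "\<dots> = form \<epsilon> f g + c * form \<epsilon> f h"
    unfolding form_def using assms by (simp add: L2_integrable_mult trunc_L2)
  finally show ?thesis .
qed

text \<open>Fubini's theorem is applicable because the truncated kernel is bounded.\<close>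

lemma form_antisym:
  assumes \<epsilon>: "\<epsilon> > 0" and f: "f \<in> L2 M" and g: "g \<in> L2 M"
  shows "form \<epsilon> f g = - form \<epsilon> g f"
proof -
  let ?h = "\<lambda>x y. trunc_kernel \<epsilon> x y * f y * g x"
  obtain c where c: "c \<ge> 0" "\<And>x y. \<bar>trunc_kernel \<epsilon> x y\<bar> \<le> c"
    using trunc_kernel_bounded[OF \<epsilon>] by blast
  note f' = L2_integrable[OF finite_measure_axioms f] and g' = L2_integrable[OF finite_measure_axioms g]
  note [measurable] = L2_measurable[OF f] L2_measurable[OF g]
  have fg: "integrable (M \<Otimes>\<^sub>M M) (\<lambda>(x, y). g x * f y)"
    by (rule pair.Fubini_integrable) (use f' g' in \<open>simp_all add: abs_mult\<close>)
  have "integrable (M \<Otimes>\<^sub>M M) (\<lambda>(x, y). ?h x y)"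
  proof (rule Bochner_Integration.integrable_bound)
    show "integrable (M \<Otimes>\<^sub>M M) (\<lambda>p. c * (case p of (x, y) \<Rightarrow> g x * f y))" using fg by simp
    have "(\<lambda>p. trunc_kernel \<epsilon> (fst p) (snd p) * f (snd p) * g (fst p)) \<in> borel_measurable (M \<Otimes>\<^sub>M M)"
      by (intro borel_measurable_times trunc_kernel_measurable) measurable
    then show "(\<lambda>(x, y). ?h x y) \<in> borel_measurable (M \<Otimes>\<^sub>M M)" by (simp add: case_prod_beta')
    show "AE p in M \<Otimes>\<^sub>M M. norm (case p of (x, y) \<Rightarrow> ?h x y)
        \<le> norm (c * (case p of (x, y) \<Rightarrow> g x * f y))"
    proof (rule AE_I2, clarify)
      fix x y
      have "\<bar>trunc_kernel \<epsilon> x y\<bar> * \<bar>f y * g x\<bar> \<le> c * \<bar>f y * g x\<bar>"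
        by (intro mult_right_mono c) simp
      then show "norm (?h x y) \<le> norm (c * (g x * f y))"
        using c(1) by (simp add: abs_mult mult_ac)
    qed
  qed
  then have "(LINT y|M. LINT x|M. ?h x y) = (LINT x|M. LINT y|M. ?h x y)"
    by (rule pair.Fubini_integral)
  moreover have "(LINT x|M. LINT y|M. ?h x y) = form \<epsilon> f g"
    unfolding form_def trunc_eq by simp
  moreover have "(LINT y|M. LINT x|M. ?h x y) = - form \<epsilon> g f"
  proof -
    have "(LINT x|M. ?h x y) = - (trunc \<epsilon> g y * f y)" for y
    proof -
      have "(LINT x|M. ?h x y) = (LINT x|M. - (trunc_kernel \<epsilon> y x * g x * f y))"
        by (subst trunc_kernel_antisym) (simp add: mult_ac)
      then show ?thesis unfolding trunc_eq by simp
    qed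
    then show ?thesis unfolding form_def by simp
  qed
  ultimately show ?thesis by simp
qed

lemma form_bound:
  assumes \<epsilon>: "\<epsilon> > 0" and f: "f \<in> L2 M" and g: "g \<in> L2 M"
  shows "\<bar>form \<epsilon> f g\<bar> \<le> sqrt (C * (LINT x|M. (f x)\<^sup>2)) * sqrt (LINT x|M. (g x)\<^sup>2)"
proof -
  obtain G where G: "G \<in> L2 M" "\<And>x. 0 \<le> G x" "(LINT x|M. (G x)\<^sup>2) \<le> C * (LINT x|M. (f x)\<^sup>2)"
    "AE x in M. \<forall>\<epsilon>>0. \<bar>trunc \<epsilon> f x\<bar> \<le> G x"
    using trunc_majorant[OF f] by blast
  have "(LINT x|M. (trunc \<epsilon> f x)\<^sup>2) \<le> (LINT x|M. (G x)\<^sup>2)"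
  proof (rule integral_mono_AE)
    from G(4) show "AE x in M. (trunc \<epsilon> f x)\<^sup>2 \<le> (G x)\<^sup>2"
    proof eventually_elim
      case (elim x)
      then have "\<bar>trunc \<epsilon> f x\<bar> \<le> G x" using \<epsilon> by blast
      then show ?case using power_mono[of "\<bar>trunc \<epsilon> f x\<bar>" "G x" 2] by simp
    qed
  qed (use G trunc_L2[OF \<epsilon> f] in \<open>simp_all add: L2_integrable_square\<close>)
  then have "sqrt (LINT x|M. (trunc \<epsilon> f x)\<^sup>2) \<le> sqrt (C * (LINT x|M. (f x)\<^sup>2))"
    using G(3) by simp
  then have "sqrt (LINT x|M. (trunc \<epsilon> f x)\<^sup>2) * sqrt (LINT x|M. (g x)\<^sup>2)
      \<le> sqrt (C * (LINT x|M. (f x)\<^sup>2)) * sqrt (LINT x|M. (g x)\<^sup>2)"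
    by (rule mult_right_mono) simp
  with L2_Cauchy_Schwarz[OF trunc_L2[OF \<epsilon> f] g] show ?thesis unfolding form_def by linarith
qed

text \<open>If \<open>f\<close> vanishes on an open set, the truncations of \<open>f\<close> are eventually constant at each point
  of that set, and the majorant allows passing to the limit under the integral.\<close>

lemma form_tendsto_separated:
  assumes f: "f \<in> L2 M" and g: "g \<in> L2 M" and U: "open U"
    and f0: "\<And>x. x \<in> U \<Longrightarrow> f x = 0" and g0: "AE x in M. x \<notin> U \<longrightarrow> g x = 0"
  shows "((\<lambda>\<epsilon>. form \<epsilon> f g) \<longlongrightarrow> (LINT x|M. (LINT y|M. K x y * f y) * g x)) (at_right 0)"
proof (rule tendsto_at_right_sequentially[of 0 1])
  fix S :: "nat \<Rightarrow> real"
  assume S: "\<And>n. 0 < S n" "S \<longlonglongrightarrow> 0"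
  obtain G where G: "G \<in> L2 M" "\<And>x. 0 \<le> G x" "(LINT x|M. (G x)\<^sup>2) \<le> C * (LINT x|M. (f x)\<^sup>2)"
    "AE x in M. \<forall>\<epsilon>>0. \<bar>trunc \<epsilon> f x\<bar> \<le> G x"
    using trunc_majorant[OF f] by blast
  show "(\<lambda>n. form (S n) f g) \<longlonglongrightarrow> (LINT x|M. (LINT y|M. K x y * f y) * g x)"
    unfolding form_def
  proof (rule integral_dominated_convergence[where w = "\<lambda>x. G x * \<bar>g x\<bar>"])
    show "(\<lambda>x. (LINT y|M. K x y * f y) * g x) \<in> borel_measurable M"
      by (intro borel_measurable_times kernel_integral_measurable K_measurable_pair L2_measurable f g)
    show "(\<lambda>x. trunc (S n) f x * g x) \<in> borel_measurable M" for n
      by (intro borel_measurable_times trunc_measurable L2_measurable f g)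
    show "integrable M (\<lambda>x. G x * \<bar>g x\<bar>)"
      by (rule L2_integrable_mult[OF G(1) L2_abs[OF g]])
    show "AE x in M. norm (trunc (S n) f x * g x) \<le> G x * \<bar>g x\<bar>" for n
      using G(4) by eventually_elim (simp add: abs_mult mult_right_mono S(1))
    show "AE x in M. (\<lambda>n. trunc (S n) f x * g x) \<longlonglongrightarrow> (LINT y|M. K x y * f y) * g x"
      using g0
    proof eventually_elim
      case (elim x)
      show ?case
      proof (cases "x \<in> U")
        case True
        with U obtain e where e: "e > 0" "ball x e \<subseteq> U" by (meson openE)
        have "\<forall>\<^sub>F n in sequentially. S n < e" using order_tendstoD(2)[OF S(2) e(1)] .
        then have "\<forall>\<^sub>F n in sequentially. trunc (S n) f x * g x = (LINT y|M. K x y * f y) * g x"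
        proof eventually_elim
          case (elim n)
          then have eq: "trunc_kernel (S n) x y * f y = K x y * f y" for y
            using e(2) f0[of y] by (auto simp: trunc_kernel_def indicator_def subset_iff)
          show ?case unfolding trunc_eq eq ..
        qed
        then show ?thesis by (rule tendsto_eventually)
      qed (use elim in simp)
    qed
  qed
qed simp

definition form_converges :: "('a \<Rightarrow> real) \<Rightarrow> ('a \<Rightarrow> real) \<Rightarrow> bool" where
  "form_converges f g \<longleftrightarrow> (\<exists>l. ((\<lambda>\<epsilon>. form \<epsilon> f g) \<longlongrightarrow> l) (at_right 0))"

lemma eventually_pos: "\<forall>\<^sub>F \<epsilon> in at_right (0::real). \<epsilon> > 0"
  by (rule eventually_at_right_less)

lemma form_converges_add_scaled_left:
  assumes "f \<in> L2 M" "g \<in> L2 M" "h \<in> L2 M" "form_converges f h" "form_converges g h"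
  shows "form_converges (\<lambda>x. f x + c * g x) h"
proof -
  from assms obtain l m where "((\<lambda>\<epsilon>. form \<epsilon> f h) \<longlongrightarrow> l) (at_right 0)" "((\<lambda>\<epsilon>. form \<epsilon> g h) \<longlongrightarrow> m) (at_right 0)"
    unfolding form_converges_def by blast
  then have "((\<lambda>\<epsilon>. form \<epsilon> f h + c * form \<epsilon> g h) \<longlongrightarrow> l + c * m) (at_right 0)"
    by (intro tendsto_intros)
  moreover have "\<forall>\<^sub>F \<epsilon> in at_right 0. form \<epsilon> f h + c * form \<epsilon> g h = form \<epsilon> (\<lambda>x. f x + c * g x) h"
    using eventually_pos by eventually_elim (simp add: form_add_scaled_left assms)
  ultimately show ?thesis
    unfolding form_converges_def by (blast intro: Lim_transform_eventually)
qed

lemma form_converges_sym: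
  assumes "f \<in> L2 M" "g \<in> L2 M" "form_converges f g"
  shows "form_converges g f"
proof -
  from assms obtain l where "((\<lambda>\<epsilon>. form \<epsilon> f g) \<longlongrightarrow> l) (at_right 0)"
    unfolding form_converges_def by blast
  then have "((\<lambda>\<epsilon>. - form \<epsilon> f g) \<longlongrightarrow> - l) (at_right 0)" by (intro tendsto_intros)
  moreover have "\<forall>\<^sub>F \<epsilon> in at_right 0. - form \<epsilon> f g = form \<epsilon> g f"
    using eventually_pos by eventually_elim (simp add: form_antisym[OF _ assms(2,1)])
  ultimately show ?thesis
    unfolding form_converges_def by (blast intro: Lim_transform_eventually)
qed

text \<open>The form is bounded in \<open>L\<^sup>2\<close> uniformly in the truncation radius.\<close>

lemma form_converges_limit:
  assumes f: "f \<in> L2 M" and g: "g \<in> L2 M" and s: "\<And>n. s n \<in> L2 M" "\<And>n. form_converges (s n) g"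
    and lim: "(\<lambda>n. LINT x|M. (f x - s n x)\<^sup>2) \<longlonglongrightarrow> 0"
  shows "form_converges f g"
  unfolding form_converges_def
proof (rule tendsto_of_uniform_approximation)
  fix e :: real assume "e > 0"
  let ?b = "\<lambda>n. sqrt (C * (LINT x|M. (f x - s n x)\<^sup>2)) * sqrt (LINT x|M. (g x)\<^sup>2)"
  have "?b \<longlonglongrightarrow> sqrt (C * 0) * sqrt (LINT x|M. (g x)\<^sup>2)"
    by (intro tendsto_intros lim)
  then have "?b \<longlonglongrightarrow> 0" by simp
  from order_tendstoD(2)[OF this \<open>e > 0\<close>] obtain n where n: "?b n < e"
    unfolding eventually_sequentially by blast
  from s(2) obtain l where l: "((\<lambda>\<epsilon>. form \<epsilon> (s n) g) \<longlongrightarrow> l) (at_right 0)"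
    unfolding form_converges_def by blast
  have "\<forall>\<^sub>F \<epsilon> in at_right 0. \<bar>form \<epsilon> f g - form \<epsilon> (s n) g\<bar> \<le> e"
    using eventually_pos
  proof eventually_elim
    case (elim \<epsilon>)
    have "form \<epsilon> f g - form \<epsilon> (s n) g = form \<epsilon> (\<lambda>x. f x - s n x) g"
      using form_add_scaled_left[OF elim f s(1) g, of "-1" n] by simp
    also have "\<bar>\<dots>\<bar> \<le> ?b n"
      by (rule form_bound[OF elim L2_diff[OF f s(1)] g])
    finally show ?case using n by linarith
  qed
  with l show "\<exists>h' l. (h' \<longlongrightarrow> l) (at_right 0) \<and> (\<forall>\<^sub>F \<epsilon> in at_right 0. \<bar>form \<epsilon> f g - h' \<epsilon>\<bar> \<le> e)"
    by blast
qed simp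

lemma form_converges_disjoint:
  assumes A: "A \<in> sets M" and B: "B \<in> continuity_sets M" and disj: "A \<inter> B = {}"
  shows "form_converges (indicat_real A) (indicat_real B)"
proof -
  have "B \<in> sets M" using B by (simp add: continuity_sets_def)
  have "frontier B \<in> null_sets M" using B by (simp add: continuity_sets_def)
  then have "AE x in M. x \<notin> frontier B" by (rule AE_not_in)
  then have "AE x in M. x \<notin> interior B \<longrightarrow> indicat_real B x = 0"
    by eventually_elim (use closure_subset[of B] in \<open>auto simp: frontier_def indicator_def\<close>)
  moreover have "indicat_real A x = 0" if "x \<in> interior B" for x
    using that disj interior_subset[of B] by (auto simp: indicator_def)
  ultimately show ?thesis
    unfolding form_converges_def
    using form_tendsto_separated[OF L2_indicator L2_indicator open_interior, of A B B]
      A \<open>B \<in> sets M\<close> finite_measure_axioms by blast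
qed

lemma form_self: "\<epsilon> > 0 \<Longrightarrow> f \<in> L2 M \<Longrightarrow> form \<epsilon> f f = 0"
  using form_antisym[of \<epsilon> f f] by simp

text \<open>With \<open>A \<inter> B\<close> in both arguments the form vanishes by antisymmetry; the remaining parts pair
  disjoint sets the second of which has null boundary.\<close>

lemma form_converges_indicator:
  assumes A: "A \<in> continuity_sets M" and B: "B \<in> continuity_sets M"
  shows "form_converges (indicat_real A) (indicat_real B)"
proof -
  have m: "A \<in> sets M" "B \<in> sets M" using A B by (simp_all add: continuity_sets_def)
  note L = L2_indicator[OF finite_measure_axioms]
  have AB: "A \<inter> B \<in> continuity_sets M"
    using Int_stable_continuity_sets[OF borel] A B by (auto simp: Int_stable_def)
  have "- A \<in> sets M" using sets.compl_sets[OF m(1)] by (simp add: Compl_eq_Diff_UNIV)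
  then have "- A \<in> continuity_sets M" using A by (simp add: continuity_sets_def)
  then have BA: "B \<inter> - A \<in> continuity_sets M"
    using Int_stable_continuity_sets[OF borel] B by (auto simp: Int_stable_def)
  have 1: "form_converges (indicat_real (A - B)) (indicat_real B)"
    by (rule form_converges_disjoint) (use m B in auto)
  have 2: "form_converges (indicat_real (A \<inter> B)) (indicat_real (B \<inter> - A))"
    by (rule form_converges_disjoint[OF _ BA]) (use m in auto)
  have "\<forall>\<^sub>F \<epsilon> in at_right 0. form \<epsilon> (indicat_real (A \<inter> B)) (indicat_real (A \<inter> B)) = 0"
    using eventually_pos by eventually_elim (use m in \<open>simp add: form_self L\<close>)
  then have 3: "form_converges (indicat_real (A \<inter> B)) (indicat_real (A \<inter> B))"
    unfolding form_converges_def by (blast intro: tendsto_eventually)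
  have m': "A \<inter> B \<in> sets M" "B \<inter> - A \<in> sets M" "A - B \<in> sets M"
    using m BA by (auto simp: continuity_sets_def)
  have eqB: "indicat_real B = (\<lambda>x. indicat_real (B \<inter> - A) x + 1 * indicat_real (A \<inter> B) x)"
    and eqA: "indicat_real A = (\<lambda>x. indicat_real (A - B) x + 1 * indicat_real (A \<inter> B) x)"
    by (auto simp: indicator_def fun_eq_iff)
  have "form_converges (indicat_real B) (indicat_real (A \<inter> B))"
    by (subst eqB, intro form_converges_add_scaled_left form_converges_sym[OF _ _ 2] L m' 3)
  then have "form_converges (indicat_real (A \<inter> B)) (indicat_real B)"
    by (rule form_converges_sym[OF L[OF m(2)] L[OF m'(1)]])
  then show ?thesis
    by (subst eqA, intro form_converges_add_scaled_left L m m' 1)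
qed

text \<open>Density is used in one argument at a time: first for \<open>f\<close> against indicators, then, exchanging
  the arguments by antisymmetry, against every function.\<close>

lemma form_converges_all:
  assumes f: "f \<in> L2 M" and g: "g \<in> L2 M"
  shows "form_converges f g"
proof -
  have cs: "A \<in> sets M" if "A \<in> continuity_sets M" for A
    using that by (simp add: continuity_sets_def)
  have UNIV: "UNIV \<in> continuity_sets M"
    using sets.top[of M] by (simp add: continuity_sets_def)
  note L = L2_indicator[OF finite_measure_axioms]
  have extend: "form_converges f g"
    if "f \<in> L2 M" "g \<in> L2 M"
      and "\<And>A. A \<in> continuity_sets M \<Longrightarrow> form_converges (indicat_real A) g" for f g
    using finite_measure_axioms sigma_sets_continuity_sets[OF finite_measure_axioms borel]
      Int_stable_continuity_sets[OF borel] that(1)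
  proof (induction rule: L2_induct)
    case (generator A)
    then show ?case by (rule that)
  next
    case space
    then show ?case using that(3)[OF UNIV] by simp
  next
    case (linear f h c)
    then show ?case using that(2) by (intro form_converges_add_scaled_left)
  next
    case (limit f s)
    then show ?case using that(2) by (intro form_converges_limit[of f g s])
  qed
  have "form_converges f (indicat_real B)" if "f \<in> L2 M" and B: "B \<in> continuity_sets M" for f B
    by (rule extend[OF that(1) L[OF cs[OF B]] form_converges_indicator[OF _ B]])
  then have "form_converges (indicat_real B) f" if "B \<in> continuity_sets M" "f \<in> L2 M" for f B
    using form_converges_sym[OF that(2) L[OF cs[OF that(1)]]] that by blast
  then show ?thesis using extend[OF f g] g by blast
qed

section \<open>The limit operator\<close>

definition weak_form :: "('a \<Rightarrow> real) \<Rightarrow> ('a \<Rightarrow> real) \<Rightarrow> real" where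
  "weak_form f g = Lim (at_right 0) (\<lambda>\<epsilon>. form \<epsilon> f g)"

lemma weak_form_eqI: "((\<lambda>\<epsilon>. form \<epsilon> f g) \<longlongrightarrow> l) (at_right 0) \<Longrightarrow> weak_form f g = l"
  unfolding weak_form_def by (rule tendsto_Lim) simp_all

lemma form_tendsto_weak_form:
  assumes "f \<in> L2 M" "g \<in> L2 M"
  shows "((\<lambda>\<epsilon>. form \<epsilon> f g) \<longlongrightarrow> weak_form f g) (at_right 0)"
  using form_converges_all[OF assms] weak_form_eqI unfolding form_converges_def by blast

lemma weak_form_add_scaled_left:
  assumes "f \<in> L2 M" "g \<in> L2 M" "h \<in> L2 M"
  shows "weak_form (\<lambda>x. f x + c * g x) h = weak_form f h + c * weak_form g h"
proof (rule weak_form_eqI)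
  have "\<forall>\<^sub>F \<epsilon> in at_right 0. form \<epsilon> f h + c * form \<epsilon> g h = form \<epsilon> (\<lambda>x. f x + c * g x) h"
    using eventually_pos by eventually_elim (simp add: form_add_scaled_left assms)
  moreover have "((\<lambda>\<epsilon>. form \<epsilon> f h + c * form \<epsilon> g h) \<longlongrightarrow> weak_form f h + c * weak_form g h) (at_right 0)"
    by (intro tendsto_intros form_tendsto_weak_form assms)
  ultimately show "((\<lambda>\<epsilon>. form \<epsilon> (\<lambda>x. f x + c * g x) h)
      \<longlongrightarrow> weak_form f h + c * weak_form g h) (at_right 0)"
    by (rule Lim_transform_eventually[rotated])
qed

lemma weak_form_add_scaled_right:
  assumes "f \<in> L2 M" "g \<in> L2 M" "h \<in> L2 M"
  shows "weak_form f (\<lambda>x. g x + c * h x) = weak_form f g + c * weak_form f h"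
proof (rule weak_form_eqI)
  have "\<forall>\<^sub>F \<epsilon> in at_right 0. form \<epsilon> f g + c * form \<epsilon> f h = form \<epsilon> f (\<lambda>x. g x + c * h x)"
    using eventually_pos by eventually_elim (simp add: form_add_scaled_right assms)
  moreover have "((\<lambda>\<epsilon>. form \<epsilon> f g + c * form \<epsilon> f h) \<longlongrightarrow> weak_form f g + c * weak_form f h) (at_right 0)"
    by (intro tendsto_intros form_tendsto_weak_form assms)
  ultimately show "((\<lambda>\<epsilon>. form \<epsilon> f (\<lambda>x. g x + c * h x))
      \<longlongrightarrow> weak_form f g + c * weak_form f h) (at_right 0)"
    by (rule Lim_transform_eventually[rotated])
qed

lemma weak_form_self: "f \<in> L2 M \<Longrightarrow> weak_form f f = 0"
  by (rule weak_form_eqI, rule tendsto_eventually, rule eventually_mono[OF eventually_pos], rule form_self)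

lemma weak_form_bound:
  assumes "f \<in> L2 M" "g \<in> L2 M"
  shows "\<bar>weak_form f g\<bar> \<le> sqrt (C * (LINT x|M. (f x)\<^sup>2)) * sqrt (LINT x|M. (g x)\<^sup>2)"
proof (rule tendsto_upperbound[OF tendsto_rabs[OF form_tendsto_weak_form[OF assms]]])
  show "\<forall>\<^sub>F \<epsilon> in at_right 0. \<bar>form \<epsilon> f g\<bar> \<le> sqrt (C * (LINT x|M. (f x)\<^sup>2)) * sqrt (LINT x|M. (g x)\<^sup>2)"
    using eventually_pos by eventually_elim (rule form_bound[OF _ assms])
qed simp

lemma weak_form_le_majorant:
  assumes f: "f \<in> L2 M" and g: "g \<in> L2 M" and G: "G \<in> L2 M"
    and maj: "AE x in M. \<forall>\<epsilon>>0. \<bar>trunc \<epsilon> f x\<bar> \<le> G x"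
  shows "\<bar>weak_form f g\<bar> \<le> (LINT x|M. G x * \<bar>g x\<bar>)"
proof (rule tendsto_upperbound[OF tendsto_rabs[OF form_tendsto_weak_form[OF f g]]])
  show "\<forall>\<^sub>F \<epsilon> in at_right 0. \<bar>form \<epsilon> f g\<bar> \<le> (LINT x|M. G x * \<bar>g x\<bar>)"
    using eventually_pos
  proof eventually_elim
    case (elim \<epsilon>)
    have "\<bar>form \<epsilon> f g\<bar> \<le> (LINT x|M. \<bar>trunc \<epsilon> f x * g x\<bar>)"
      unfolding form_def by (rule integral_abs_bound)
    also have "\<dots> \<le> (LINT x|M. G x * \<bar>g x\<bar>)"
    proof (rule integral_mono_AE)
      show "integrable M (\<lambda>x. \<bar>trunc \<epsilon> f x * g x\<bar>)"
        by (intro integrable_abs L2_integrable_mult trunc_L2 elim f g)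
      show "integrable M (\<lambda>x. G x * \<bar>g x\<bar>)"
        by (intro L2_integrable_mult G L2_abs g)
      show "AE x in M. \<bar>trunc \<epsilon> f x * g x\<bar> \<le> G x * \<bar>g x\<bar>"
        using maj by eventually_elim (simp add: abs_mult mult_right_mono elim)
    qed
    finally show ?case .
  qed
qed simp

text \<open>The limit form is represented by a function: adding the integral of the majorant \<open>G\<close> turns
  the set function \<open>A \<mapsto> weak_form f 1\<^sub>A\<close> into a nonnegative additive one that is at most
  \<open>\<integral>\<^sub>A 2 G\<close>. It is therefore an absolutely continuous measure, and subtracting \<open>G\<close> from its
  Radon-Nikodym derivative gives a function bounded by \<open>G\<close>.\<close>

lemma weak_form_represented:
  assumes f: "f \<in> L2 M"
  shows "\<exists>u\<in>L2 M. (LINT x|M. (u x)\<^sup>2) \<le> C * (LINT x|M. (f x)\<^sup>2) \<and>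
    (\<forall>g\<in>L2 M. weak_form f g = (LINT x|M. u x * g x))"
proof -
  obtain G where G: "G \<in> L2 M" "\<And>x. 0 \<le> G x" "(LINT x|M. (G x)\<^sup>2) \<le> C * (LINT x|M. (f x)\<^sup>2)"
    "AE x in M. \<forall>\<epsilon>>0. \<bar>trunc \<epsilon> f x\<bar> \<le> G x"
    using trunc_majorant[OF f] by blast
  note ind = L2_indicator[OF finite_measure_axioms]
  have Gint: "integrable M (\<lambda>x. G x * indicat_real A x)" if "A \<in> sets M" for A
    by (rule L2_integrable_mult[OF G(1) ind[OF that]])
  define p where "p A = weak_form f (indicat_real A) + (LINT x|M. G x * indicat_real A x)" for A
  have p: "0 \<le> p A" "p A \<le> 2 * (LINT x|M. G x * indicat_real A x)" if "A \<in> sets M" for A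
    using weak_form_le_majorant[OF f ind[OF that] G(1,4)] unfolding p_def by auto
  have p_add: "p (A \<union> B) = p A + p B" if "A \<in> sets M" "B \<in> sets M" "A \<inter> B = {}" for A B
  proof -
    have eq: "indicat_real (A \<union> B) = (\<lambda>x. indicat_real A x + 1 * indicat_real B x)"
      using that(3) by (auto simp: indicator_def fun_eq_iff)
    show ?thesis
      unfolding p_def eq using weak_form_add_scaled_right[OF f ind[OF that(1)] ind[OF that(2)], of 1]
        Gint[OF that(1)] Gint[OF that(2)] by (simp add: distrib_left)
  qed
  have p_empty: "p {} = 0" using p[of "{}"] by simp
  have pos: "positive (sets M) (\<lambda>A. ennreal (p A))" by (simp add: positive_def p_empty)
  have ca: "countably_additive (sets M) (\<lambda>A. ennreal (p A))"
  proof (rule sets.empty_continuous_imp_countably_additive[OF pos])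
    show "additive (sets M) (\<lambda>A. ennreal (p A))"
      unfolding additive_def using p_add p(1) by (simp add: ennreal_plus)
    fix A :: "nat \<Rightarrow> 'a set" assume A: "range A \<subseteq> sets M" "decseq A" "(\<Inter>i. A i) = {}"
    have Am: "A i \<in> sets M" for i using A(1) by auto
    have "(\<lambda>i. LINT x|M. G x * indicat_real (A i) x) \<longlonglongrightarrow> (LINT x|M. 0)"
    proof (rule integral_dominated_convergence[where w = G])
      show "AE x in M. (\<lambda>i. G x * indicat_real (A i) x) \<longlonglongrightarrow> 0"
      proof (rule AE_I2)
        fix x
        have "(\<lambda>i. G x * indicat_real (A i) x) \<longlonglongrightarrow> G x * indicat_real (\<Inter>i. A i) x"
          by (intro tendsto_intros LIMSEQ_indicator_decseq A)
        then show "(\<lambda>i. G x * indicat_real (A i) x) \<longlonglongrightarrow> 0" by (simp add: A(3))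
      qed
      show "integrable M G" by (rule L2_integrable[OF finite_measure_axioms G(1)])
      show "(\<lambda>x. G x * indicat_real (A i) x) \<in> borel_measurable M" for i
        using Gint[OF Am] by (rule borel_measurable_integrable)
      show "AE x in M. norm (G x * indicat_real (A i) x) \<le> G x" for i
        by (intro AE_I2) (use G(2) in \<open>auto simp: indicator_def\<close>)
    qed simp
    then have up: "(\<lambda>i. 2 * (LINT x|M. G x * indicat_real (A i) x)) \<longlonglongrightarrow> 0"
      by (intro tendsto_mult_right_zero) simp
    have "(\<lambda>i. p (A i)) \<longlonglongrightarrow> 0"
      by (rule tendsto_sandwich[OF _ _ tendsto_const up]) (simp_all add: p[OF Am])
    then show "(\<lambda>i. ennreal (p (A i))) \<longlonglongrightarrow> 0"
      using tendsto_ennrealI[of "\<lambda>i. p (A i)" 0] by simp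
  qed simp
  define N where "N = measure_of UNIV (sets M) (\<lambda>A. ennreal (p A))"
  have sa: "sigma_algebra UNIV (sets M)" using sets.sigma_algebra_axioms[of M] by simp
  have N_sets: "sets N = sets M"
    unfolding N_def using sigma_algebra.sets_measure_of_eq[OF sa] by simp
  have N: "emeasure N A = ennreal (p A)" if "A \<in> sets M" for A
    unfolding N_def by (rule emeasure_measure_of_sigma[OF sa pos ca that])
  have "absolutely_continuous M N"
    unfolding absolutely_continuous_def
  proof
    fix A assume A: "A \<in> null_sets M"
    then have Am: "A \<in> sets M" by auto
    have "(LINT x|M. G x * indicat_real A x) = (LINT x|M. 0)"
      by (rule integral_cong_AE)
        (use AE_not_in[OF A] Gint[OF Am] in \<open>auto simp: indicator_def elim!: eventually_mono\<close>)
    then have "p A = 0" using p[OF Am] by simp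
    then show "A \<in> null_sets N" using N[OF Am] Am N_sets by (simp add: null_sets_def)
  qed
  from Radon_Nikodym[OF this N_sets] obtain h where
    h: "h \<in> borel_measurable M" "density M h = N" by blast
  have h_int: "(\<integral>\<^sup>+ x. h x * indicator A x \<partial>M) = ennreal (p A)" if "A \<in> sets M" for A
    using emeasure_density[OF h(1) that] N[OF that] h(2) by simp
  define r where "r x = enn2real (h x)" for x
  have "(\<integral>\<^sup>+ x. h x \<partial>M) \<noteq> \<infinity>" using h_int[of UNIV] sets.top[of M] by simp
  then have h_fin: "AE x in M. h x \<noteq> \<infinity>" by (rule nn_integral_PInf_AE[OF h(1)])
  have rm: "r \<in> borel_measurable M" unfolding r_def using h(1) by measurable
  have r_nn: "(\<integral>\<^sup>+ x. ennreal (r x * indicat_real A x) \<partial>M) = ennreal (p A)" if "A \<in> sets M" for A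
  proof -
    have "(\<integral>\<^sup>+ x. ennreal (r x * indicat_real A x) \<partial>M) = (\<integral>\<^sup>+ x. h x * indicator A x \<partial>M)"
      by (rule nn_integral_cong_AE)
        (use h_fin in \<open>eventually_elim, auto simp: r_def indicator_def less_top\<close>)
    then show ?thesis using h_int[OF that] by simp
  qed
  have r_int: "(LINT x|M. r x * indicat_real A x) = p A" "integrable M (\<lambda>x. r x * indicat_real A x)"
    if A: "A \<in> sets M" for A
  proof -
    have m: "(\<lambda>x. r x * indicat_real A x) \<in> borel_measurable M" using rm A by measurable
    have nonneg: "0 \<le> r x * indicat_real A x" for x by (simp add: r_def)
    show "integrable M (\<lambda>x. r x * indicat_real A x)"
      using r_nn[OF A] nonneg by (intro integrableI_nonneg m) auto
    show "(LINT x|M. r x * indicat_real A x) = p A"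
      using r_nn[OF A] nonneg p(1)[OF A] by (intro integral_eq_nn_integral[OF m, THEN trans]) auto
  qed
  have r_le: "AE x in M. r x \<le> 2 * G x"
  proof -
    define A where "A = {x. 2 * G x < r x}"
    have "{x \<in> space M. 2 * G x < r x} \<in> sets M"
      using L2_measurable[OF G(1)] rm by measurable
    then have A: "A \<in> sets M" by (simp add: A_def)
    let ?d = "\<lambda>x. r x * indicat_real A x - 2 * (G x * indicat_real A x)"
    have int: "integrable M ?d" using r_int(2)[OF A] Gint[OF A] by simp
    have nonneg: "0 \<le> ?d x" for x by (auto simp: A_def indicator_def)
    have "integral\<^sup>L M ?d \<le> 0"
      using r_int[OF A] Gint[OF A] p(2)[OF A] by simp
    moreover have "0 \<le> integral\<^sup>L M ?d" by (rule integral_nonneg_AE) (use nonneg in simp)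
    ultimately have "AE x in M. ?d x = 0"
      using integral_nonneg_eq_0_iff_AE[OF int] nonneg by simp
    then show ?thesis by eventually_elim (auto simp: A_def indicator_def split: if_splits)
  qed
  define u where "u x = r x - G x" for x
  have um: "u \<in> borel_measurable M" unfolding u_def using L2_measurable[OF G(1)] rm by measurable
  have u_le: "AE x in M. \<bar>u x\<bar> \<le> \<bar>G x\<bar>"
    using r_le by eventually_elim (use G(2) in \<open>auto simp: u_def r_def abs_le_iff\<close>)
  have u: "u \<in> L2 M" by (rule L2_dominated[OF G(1) um u_le])
  have "(LINT x|M. (u x)\<^sup>2) \<le> (LINT x|M. (G x)\<^sup>2)"
    using u_le by (intro integral_mono_AE L2_integrable_square u G) (simp add: abs_le_square_iff)
  then have u_bound: "(LINT x|M. (u x)\<^sup>2) \<le> C * (LINT x|M. (f x)\<^sup>2)" using G(3) by linarith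
  have u_ind: "weak_form f (indicat_real A) = (LINT x|M. u x * indicat_real A x)" if "A \<in> sets M" for A
    using r_int[OF that] Gint[OF that] unfolding u_def p_def by (simp add: left_diff_distrib)
  have "weak_form f g = (LINT x|M. u x * g x)" if "g \<in> L2 M" for g
    using finite_measure_axioms sets.sigma_sets_eq[of M, symmetric] sets.Int_stable[of M] that
  proof (induction rule: L2_induct)
    case (generator A)
    then show ?case by (rule u_ind)
  next
    case space
    show ?case by (rule u_ind[OF sets.top])
  next
    case (linear g h c)
    have "(LINT x|M. u x * (g x + c * h x)) = (LINT x|M. u x * g x + c * (u x * h x))"
      by (simp add: algebra_simps)
    also have "\<dots> = (LINT x|M. u x * g x) + c * (LINT x|M. u x * h x)"
      using linear u by (simp add: L2_integrable_mult)
    finally show ?case using linear weak_form_add_scaled_right[OF f] by simp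
  next
    case (limit g s)
    let ?d = "\<lambda>n x. g x - s n x"
    let ?b = "\<lambda>n. (sqrt (C * (LINT x|M. (f x)\<^sup>2)) + sqrt (LINT x|M. (u x)\<^sup>2)) * sqrt (LINT x|M. (?d n x)\<^sup>2)"
    have "\<bar>weak_form f g - (LINT x|M. u x * g x)\<bar> \<le> ?b n" for n
    proof -
      have d: "?d n \<in> L2 M" by (rule L2_diff[OF limit.hyps(1,2)])
      have "weak_form f (?d n) = weak_form f g - weak_form f (s n)"
        using weak_form_add_scaled_right[OF f limit.hyps(1,2), of "-1" n] by simp
      moreover have "(LINT x|M. u x * ?d n x) = (LINT x|M. u x * g x) - (LINT x|M. u x * s n x)"
        using L2_integrable_mult[OF u limit.hyps(1)] L2_integrable_mult[OF u limit.hyps(2)]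
        by (simp add: right_diff_distrib)
      ultimately have "weak_form f g - (LINT x|M. u x * g x) = weak_form f (?d n) - (LINT x|M. u x * ?d n x)"
        using limit.IH[of n] by simp
      also have "\<bar>\<dots>\<bar> \<le> \<bar>weak_form f (?d n)\<bar> + \<bar>LINT x|M. u x * ?d n x\<bar>" by (rule abs_triangle_ineq4)
      also have "\<dots> \<le> ?b n"
        using weak_form_bound[OF f d] L2_Cauchy_Schwarz[OF u d] unfolding distrib_right by (rule add_mono)
      finally show ?thesis .
    qed
    then have le: "\<exists>N. \<forall>n\<ge>N. \<bar>weak_form f g - (LINT x|M. u x * g x)\<bar> \<le> ?b n" by blast
    have "?b \<longlonglongrightarrow> (sqrt (C * (LINT x|M. (f x)\<^sup>2)) + sqrt (LINT x|M. (u x)\<^sup>2)) * sqrt 0"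
      by (intro tendsto_intros limit.hyps(3))
    from LIMSEQ_le_const[OF this le] have "\<bar>weak_form f g - (LINT x|M. u x * g x)\<bar> \<le> 0"
      by simp
    then show ?case by simp
  qed
  with u u_bound show ?thesis by blast
qed

definition weak_op :: "('a \<Rightarrow> real) \<Rightarrow> 'a \<Rightarrow> real" where
  "weak_op f = (SOME u. u \<in> L2 M \<and> (LINT x|M. (u x)\<^sup>2) \<le> C * (LINT x|M. (f x)\<^sup>2) \<and>
    (\<forall>g\<in>L2 M. weak_form f g = (LINT x|M. u x * g x)))"

lemma
  assumes "f \<in> L2 M"
  shows weak_op_L2: "weak_op f \<in> L2 M"
    and weak_op_bound: "(LINT x|M. (weak_op f x)\<^sup>2) \<le> C * (LINT x|M. (f x)\<^sup>2)"
    and weak_op_represents: "g \<in> L2 M \<Longrightarrow> weak_form f g = (LINT x|M. weak_op f x * g x)"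
proof -
  have "\<exists>u. u \<in> L2 M \<and> (LINT x|M. (u x)\<^sup>2) \<le> C * (LINT x|M. (f x)\<^sup>2) \<and>
    (\<forall>g\<in>L2 M. weak_form f g = (LINT x|M. u x * g x))"
    using weak_form_represented[OF assms] by blast
  from someI_ex[OF this] show "weak_op f \<in> L2 M"
    "(LINT x|M. (weak_op f x)\<^sup>2) \<le> C * (LINT x|M. (f x)\<^sup>2)"
    "g \<in> L2 M \<Longrightarrow> weak_form f g = (LINT x|M. weak_op f x * g x)"
    unfolding weak_op_def by blast+
qed

lemma weak_form_cong_AE:
  assumes f: "f \<in> L2 M" and f': "f' \<in> L2 M" and eq: "AE x in M. f x = f' x"
  shows "weak_form f g = weak_form f' g"
proof -
  have "trunc \<epsilon> f x = trunc \<epsilon> f' x" for \<epsilon> x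
    unfolding trunc_eq
    by (intro integral_cong_AE borel_measurable_times trunc_kernel_measurable_snd L2_measurable f f')
      (use eq in \<open>auto elim!: eventually_mono\<close>)
  then have "form \<epsilon> f g = form \<epsilon> f' g" for \<epsilon> unfolding form_def by simp
  then show ?thesis unfolding weak_form_def by simp
qed

lemma bounded_linear_weak_op: "bounded_linear_L2 M weak_op"
proof -
  have add_scaled: "AE x in M. weak_op (\<lambda>x. f x + c * g x) x = weak_op f x + c * weak_op g x"
    if f: "f \<in> L2 M" and g: "g \<in> L2 M" for f g c
  proof (rule L2_eq_AE)
    show "weak_op (\<lambda>x. f x + c * g x) \<in> L2 M" by (intro weak_op_L2 L2_add_scaled f g)
    show "(\<lambda>x. weak_op f x + c * weak_op g x) \<in> L2 M" by (intro weak_op_L2 L2_add_scaled f g)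
    fix k assume k: "k \<in> L2 M"
    have "(LINT x|M. (weak_op f x + c * weak_op g x) * k x)
        = (LINT x|M. weak_op f x * k x + c * (weak_op g x * k x))"
      by (simp add: algebra_simps)
    also have "\<dots> = weak_form f k + c * weak_form g k"
      using f g k by (simp add: L2_integrable_mult weak_op_L2 weak_op_represents)
    also have "\<dots> = (LINT x|M. weak_op (\<lambda>x. f x + c * g x) x * k x)"
      using f g k by (simp add: weak_form_add_scaled_left weak_op_represents[symmetric] L2_add_scaled)
    finally show "(LINT x|M. weak_op (\<lambda>x. f x + c * g x) x * k x)
        = (LINT x|M. (weak_op f x + c * weak_op g x) * k x)" ..
  qed
  have cong: "AE x in M. weak_op f x = weak_op g x"
    if "f \<in> L2 M" "g \<in> L2 M" "AE x in M. f x = g x" for f g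
    using weak_form_cong_AE[OF that]
    by (intro L2_eq_AE weak_op_L2 that) (simp add: weak_op_represents[symmetric] that)
  have zero: "AE x in M. weak_op (\<lambda>x. 0) x = 0"
  proof -
    have "(LINT x|M. (weak_op (\<lambda>x. 0) x)\<^sup>2) \<le> 0"
      using weak_op_bound[OF L2_zero] by simp
    then have "(LINT x|M. (weak_op (\<lambda>x. 0) x)\<^sup>2) = 0"
      by (intro antisym) simp_all
    then have "AE x in M. (weak_op (\<lambda>x. 0) x)\<^sup>2 = 0"
      using integral_nonneg_eq_0_iff_AE[OF L2_integrable_square[OF weak_op_L2[OF L2_zero]]] by simp
    then show ?thesis by simp
  qed
  have add: "AE x in M. weak_op (\<lambda>x. f x + g x) x = weak_op f x + weak_op g x"
    if "f \<in> L2 M" "g \<in> L2 M" for f g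
    using add_scaled[OF that, of 1] by simp
  have scale: "AE x in M. weak_op (\<lambda>x. c * f x) x = c * weak_op f x" if "f \<in> L2 M" for f c
    using add_scaled[OF L2_zero that, of c] zero by eventually_elim simp
  show ?thesis
    unfolding bounded_linear_L2_def using weak_op_L2 cong add scale weak_op_bound by blast
qed

section \<open>Ball averages\<close>

text \<open>The ball and its complement are separated by the open ball itself, so the double integral in
  the ball average is the limit of the form.\<close>

lemma ball_average_eq_weak_form:
  assumes f: "f \<in> L2 M"
  shows "ball_average M K f z r = 1 / measure M (ball z r) *
    weak_form (\<lambda>x. f x * indicat_real (- ball z r) x) (indicat_real (ball z r))"
proof -
  have B: "ball z r \<in> sets M" "- ball z r \<in> sets M" by (auto simp: borel)
  have "((\<lambda>\<epsilon>. form \<epsilon> (\<lambda>x. f x * indicat_real (- ball z r) x) (indicat_real (ball z r)))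
    \<longlongrightarrow> (LINT x|M. (LINT y|M. K x y * (f y * indicat_real (- ball z r) y)) * indicat_real (ball z r) x))
    (at_right 0)"
    by (rule form_tendsto_separated[where U = "ball z r"])
      (use L2_mult_indicator[OF f B(2)] L2_indicator[OF finite_measure_axioms B(1)] in auto)
  then show ?thesis
    unfolding ball_average_def set_lebesgue_integral_def
    by (simp add: weak_form_eqI mult_ac)
qed

text \<open>Splitting \<open>f = f 1\<^sub>B + f 1\<^sub>X\<^sub>-\<^sub>B\<close> with \<open>B = ball z r\<close>, the average differs from the average of
  the limit operator by \<open>weak_form (f 1\<^sub>B) 1\<^sub>B / \<mu>(B)\<close>. Antisymmetry makes \<open>weak_form 1\<^sub>B 1\<^sub>B\<close>
  vanish, so \<open>f\<close> may be replaced by \<open>f - c\<close> for any constant \<open>c\<close>.\<close>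

lemma ball_average_diff_le:
  assumes f: "f \<in> L2 M"
  shows "\<bar>ball_average M K f z r - (LINT x:ball z r|M. weak_op f x) / measure M (ball z r)\<bar>
    \<le> sqrt (C * ((LINT x:ball z r|M. (f x - c)\<^sup>2) / measure M (ball z r)))"
proof -
  let ?B = "ball z r" and ?m = "measure M (ball z r)"
  let ?I = "indicat_real ?B"
  have B: "?B \<in> sets M" "- ?B \<in> sets M" by (auto simp: borel)
  have I: "?I \<in> L2 M" by (rule L2_indicator[OF finite_measure_axioms B(1)])
  have fI: "(\<lambda>x. f x * ?I x) \<in> L2 M" "(\<lambda>x. f x * indicat_real (- ?B) x) \<in> L2 M"
    by (rule L2_mult_indicator[OF f B(1)], rule L2_mult_indicator[OF f B(2)])
  have fc: "(\<lambda>x. (f x - c) * ?I x) \<in> L2 M"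
    by (intro L2_mult_indicator L2_diff f L2_const finite_measure_axioms B)
  have eqf: "(\<lambda>x. f x * indicat_real (- ?B) x + 1 * (f x * ?I x)) = f"
    by (auto simp: indicator_def fun_eq_iff)
  have "weak_form f ?I = weak_form (\<lambda>x. f x * indicat_real (- ?B) x) ?I + weak_form (\<lambda>x. f x * ?I x) ?I"
    using weak_form_add_scaled_left[OF fI(2,1) I, of 1] unfolding eqf by simp
  moreover have "weak_form (\<lambda>x. (f x - c) * ?I x) ?I = weak_form (\<lambda>x. f x * ?I x) ?I"
    using weak_form_add_scaled_left[OF fI(1) I I, of "- c"] weak_form_self[OF I]
    by (simp add: left_diff_distrib)
  moreover have "weak_form f ?I = (LINT x:?B|M. weak_op f x)"
    using weak_op_represents[OF f I] by (simp add: set_lebesgue_integral_def mult.commute)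
  ultimately have "ball_average M K f z r - (LINT x:?B|M. weak_op f x) / ?m
      = - weak_form (\<lambda>x. (f x - c) * ?I x) ?I / ?m"
    unfolding ball_average_eq_weak_form[OF f] by (simp add: add_divide_distrib)
  also have "\<bar>\<dots>\<bar> \<le> sqrt (C * (LINT x:?B|M. (f x - c)\<^sup>2)) * sqrt ?m / ?m"
  proof -
    have "(LINT x|M. ((f x - c) * ?I x)\<^sup>2) = (LINT x:?B|M. (f x - c)\<^sup>2)"
      unfolding set_lebesgue_integral_def
      by (intro Bochner_Integration.integral_cong) (auto simp: indicator_def)
    moreover have "(LINT x|M. (?I x)\<^sup>2) = ?m"
    proof -
      have "(\<lambda>x. (?I x)\<^sup>2) = ?I" by (auto simp: indicator_def fun_eq_iff)
      then show ?thesis using B(1) by simp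
    qed
    ultimately have "\<bar>weak_form (\<lambda>x. (f x - c) * ?I x) ?I\<bar> \<le> sqrt (C * (LINT x:?B|M. (f x - c)\<^sup>2)) * sqrt ?m"
      using weak_form_bound[OF fc I] by simp
    then show ?thesis by (simp add: abs_divide divide_right_mono)
  qed
  also have "\<dots> = sqrt (C * ((LINT x:?B|M. (f x - c)\<^sup>2) / ?m))"
  proof -
    have "sqrt ?m / ?m = inverse (sqrt ?m)" by (rule sqrt_divide_self_eq) simp
    then have "sqrt (C * (LINT x:?B|M. (f x - c)\<^sup>2)) * sqrt ?m / ?m
        = sqrt (C * (LINT x:?B|M. (f x - c)\<^sup>2)) / sqrt ?m"
      by (metis divide_inverse times_divide_eq_right)
    then show ?thesis by (simp add: real_sqrt_divide)
  qed
  finally show ?thesis .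
qed

text \<open>Expanding \<open>(f - f z)\<^sup>2\<close>, differentiation of the integrals of \<open>f\<^sup>2\<close> and \<open>f\<close> shows that the
  averages of \<open>(f - f z)\<^sup>2\<close> over balls around almost every \<open>z\<close> tend to \<open>0\<close>. These are exactly the
  error terms of the preceding estimate with \<open>c = f z\<close>.\<close>

lemma ball_average_tendsto_weak_op:
  assumes f: "f \<in> L2 M" and vitali: "vitali_valid M"
  shows "AE z in M. (ball_average M K f z \<longlongrightarrow> weak_op f z) (at_right 0)"
proof -
  note diff = vitali_lebesgue_differentiation[OF finite_measure_axioms borel vitali]
  note int = L2_integrable_square[OF f] L2_integrable[OF finite_measure_axioms f]
    L2_integrable[OF finite_measure_axioms weak_op_L2[OF f]]
  let ?m = "\<lambda>z r. measure M (ball z r)"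
  from diff[OF int(1)] diff[OF int(2)] diff[OF int(3)] AE_measure_ball_pos[OF finite_measure_axioms borel vitali]
  show ?thesis
  proof eventually_elim
    case (elim z)
    have "((\<lambda>r. (LINT x:ball z r|M. (f x)\<^sup>2) / ?m z r - 2 * f z * ((LINT x:ball z r|M. f x) / ?m z r)
        + (f z)\<^sup>2) \<longlongrightarrow> (f z)\<^sup>2 - 2 * f z * f z + (f z)\<^sup>2) (at_right 0)"
      by (intro tendsto_intros elim)
    moreover have "\<forall>\<^sub>F r in at_right 0.
        (LINT x:ball z r|M. (f x)\<^sup>2) / ?m z r - 2 * f z * ((LINT x:ball z r|M. f x) / ?m z r) + (f z)\<^sup>2
        = (LINT x:ball z r|M. (f x - f z)\<^sup>2) / ?m z r"
      using eventually_pos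
    proof eventually_elim
      case (elim r)
      then have pos: "?m z r > 0" using \<open>\<forall>r>0. ?m z r > 0\<close> by blast
      have "(LINT x:ball z r|M. (f x - f z)\<^sup>2)
          = (LINT x|M. indicator (ball z r) x *\<^sub>R (f x)\<^sup>2
              - 2 * f z * (indicator (ball z r) x *\<^sub>R f x) + (f z)\<^sup>2 * indicator (ball z r) x)"
        unfolding set_lebesgue_integral_def by (simp add: power2_eq_square algebra_simps)
      also have "\<dots> = (LINT x:ball z r|M. (f x)\<^sup>2) - 2 * f z * (LINT x:ball z r|M. f x)
          + (f z)\<^sup>2 * ?m z r"
        unfolding set_lebesgue_integral_def
        using integrable_mult_indicator[OF ball_sets int(1)] integrable_mult_indicator[OF ball_sets int(2)]
        by (simp add: emeasure_eq_measure)
      finally show ?case using pos by (simp add: field_simps)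
    qed
    ultimately have "((\<lambda>r. (LINT x:ball z r|M. (f x - f z)\<^sup>2) / ?m z r)
        \<longlongrightarrow> (f z)\<^sup>2 - 2 * f z * f z + (f z)\<^sup>2) (at_right 0)"
      by (rule Lim_transform_eventually)
    then have "((\<lambda>r. sqrt (C * ((LINT x:ball z r|M. (f x - f z)\<^sup>2) / ?m z r)))
        \<longlongrightarrow> sqrt (C * ((f z)\<^sup>2 - 2 * f z * f z + (f z)\<^sup>2))) (at_right 0)"
      by (intro tendsto_intros)
    then have "((\<lambda>r. sqrt (C * ((LINT x:ball z r|M. (f x - f z)\<^sup>2) / ?m z r))) \<longlongrightarrow> 0) (at_right 0)"
      by (simp add: power2_eq_square)
    then have "((\<lambda>r. ball_average M K f z r - (LINT x:ball z r|M. weak_op f x) / ?m z r) \<longlongrightarrow> 0) (at_right 0)"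
      by (rule Lim_null_comparison[rotated])
        (intro always_eventually allI, use ball_average_diff_le[OF f] in simp)
    from tendsto_add[OF this elim(3)] show ?case by simp
  qed
qed

end

theorem theorem1p4:
  fixes M :: "'a::separable_metric_space measure"
    and K :: "'a \<Rightarrow> 'a \<Rightarrow> real"
  assumes finite: "finite_measure M"
    and borel: "sets M = sets borel"
    and vitali: "vitali_valid M"
    and K_measurable: "(\<lambda>(x, y). K x y) \<in> borel_measurable (restrict_space borel {(x, y). x \<noteq> y})"
    and K_antisym: "\<And>x y. x \<noteq> y \<Longrightarrow> K x y = - K y x"
    and K_bounded: "\<And>\<delta>. \<delta> > 0 \<Longrightarrow> bounded ((\<lambda>(x, y). K x y) ` {(x, y). dist x y > \<delta>})"
    and maximal_bounded: "\<exists>C0::real. \<forall>f\<in>L2 M.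
      (\<integral>\<^sup>+ x. (maximal_op M K f x)\<^sup>2 \<partial>M) \<le> ennreal (C0 * (LINT x|M. (f x)\<^sup>2))"
  shows "\<exists>T. bounded_linear_L2 M T \<and>
    (\<forall>f\<in>L2 M. \<forall>g\<in>L2 M.
      ((\<lambda>\<epsilon>. LINT x|M. trunc_op M K \<epsilon> f x * g x) \<longlongrightarrow> (LINT x|M. T f x * g x)) (at_right 0)) \<and>
    (\<forall>f\<in>L2 M. AE z in M. (ball_average M K f z \<longlongrightarrow> T f z) (at_right 0))"
proof -
  from maximal_bounded obtain C0 where C0: "\<And>f. f \<in> L2 M \<Longrightarrow>
      (\<integral>\<^sup>+ x. (maximal_op M K f x)\<^sup>2 \<partial>M) \<le> ennreal (C0 * (LINT x|M. (f x)\<^sup>2))" by blast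
  \<comment> \<open>Off the diagonal nothing changes, and \<open>K'\<close> is Borel measurable and antisymmetric everywhere.\<close>
  define K' where "K' x y = (if x = y then 0 else K x y)" for x y
  have trunc_K': "trunc_op M K' \<epsilon> = trunc_op M K \<epsilon>" if "\<epsilon> > 0" for \<epsilon>
    using that unfolding trunc_op_def set_lebesgue_integral_def
    by (intro ext Bochner_Integration.integral_cong) (auto simp: K'_def indicator_def)
  then have maximal_eq: "maximal_op M K' = maximal_op M K"
    unfolding maximal_op_def by (intro ext SUP_cong) auto
  have average_eq: "ball_average M K' = ball_average M K"
    unfolding ball_average_def set_lebesgue_integral_def
    by (intro ext arg_cong2[where f = "(*)"] Bochner_Integration.integral_cong refl)
      (auto simp: K'_def indicator_def intro!: Bochner_Integration.integral_cong)
  interpret bounded_maximal_kernel M K' "max 0 C0"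
  proof (intro bounded_maximal_kernel.intro bounded_maximal_kernel_axioms.intro finite borel)
    have "open {(x :: 'a, y). x \<noteq> y}"
      using open_diagonal_complement by (simp add: case_prod_beta')
    then have "{p \<in> space (borel :: ('a \<times> 'a) measure). case p of (x, y) \<Rightarrow> x \<noteq> y} \<in> sets borel"
      by simp
    from measurable_If_restrict_space_iff[OF this, of "\<lambda>(x, y). K x y" "\<lambda>_. 0" borel] K_measurable
    have "(\<lambda>p. if case p of (x, y) \<Rightarrow> x \<noteq> y then case p of (x, y) \<Rightarrow> K x y else 0)
        \<in> borel_measurable borel"
      by simp
    also have "(\<lambda>p. if case p of (x, y) \<Rightarrow> x \<noteq> y then case p of (x, y) \<Rightarrow> K x y else 0)
        = (\<lambda>(x, y). K' x y)"
      by (auto simp: K'_def fun_eq_iff)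
    finally show "(\<lambda>(x, y). K' x y) \<in> borel_measurable borel" .
    show "K' x y = - K' y x" for x y using K_antisym[of x y] by (simp add: K'_def)
    show "\<exists>c. \<forall>x y. \<delta> \<le> dist x y \<longrightarrow> \<bar>K' x y\<bar> \<le> c" if "\<delta> > 0" for \<delta> :: real
    proof -
      have "\<delta> / 2 > 0" using that by simp
      from K_bounded[OF this] obtain c where
        c: "\<And>x y. dist x y > \<delta> / 2 \<Longrightarrow> \<bar>K x y\<bar> \<le> c"
        unfolding bounded_iff by fastforce
      have "\<bar>K' x y\<bar> \<le> c" if "\<delta> \<le> dist x y" for x y
        using c[of x y] that \<open>\<delta> > 0\<close> by (auto simp: K'_def)
      then show ?thesis by blast
    qed
    show "(\<integral>\<^sup>+ x. (maximal_op M K' f x)\<^sup>2 \<partial>M) \<le> ennreal (max 0 C0 * (LINT x|M. (f x)\<^sup>2))"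
      if "f \<in> L2 M" for f
      using C0[OF that] unfolding maximal_eq
      by (rule order_trans) (intro ennreal_leI mult_right_mono; simp)
  qed simp
  have "((\<lambda>\<epsilon>. LINT x|M. trunc_op M K \<epsilon> f x * g x) \<longlongrightarrow> (LINT x|M. weak_op f x * g x)) (at_right 0)"
    if "f \<in> L2 M" "g \<in> L2 M" for f g
  proof (rule Lim_transform_eventually)
    show "((\<lambda>\<epsilon>. form \<epsilon> f g) \<longlongrightarrow> (LINT x|M. weak_op f x * g x)) (at_right 0)"
      using form_tendsto_weak_form[OF that] unfolding weak_op_represents[OF that] .
    show "\<forall>\<^sub>F \<epsilon> in at_right 0. form \<epsilon> f g = (LINT x|M. trunc_op M K \<epsilon> f x * g x)"
      using eventually_pos by eventually_elim (simp add: form_def trunc_K')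
  qed
  moreover have "AE z in M. (ball_average M K f z \<longlongrightarrow> weak_op f z) (at_right 0)" if "f \<in> L2 M" for f
    using ball_average_tendsto_weak_op[OF that vitali] unfolding average_eq .
  ultimately show ?thesis using bounded_linear_weak_op by blast
qed

end
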